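(* Let $A$ be a finite abelian group of even order and exponent at least $3$, let $y\in A$ have order $2$, and let $\mathrm{Dic}(A,y)=\langle A,x \mid x^2=y,\ xax^{-1}=a^{-1}\ (a\in A)\rangle$. Let $S\subseteq\mathrm{Dic}(A,y)$ with $1\notin S$, $S^{-1}=S$ and $\langle S\rangle=\mathrm{Dic}(A,y)$, and let $D$ be a non-empty finite set of positive integers. Write $S=S_1\cup xS_2$ with $S_1,S_2\subseteq A$, and assume $S_1,S_2\in B(A)$. Then there are subsets $S_1^D,S_2^D\subseteq A$ such that, with $S^D=S_1^D\cup xS_2^D$, we have $1\notin S^D$, $(S^D)^{-1}=S^D$ and $\mathrm{Cay}(\mathrm{Dic}(A,y),S)^D=\mathrm{Cay}(\mathrm{Dic}(A,y),S^D)$. Moreover, $\mathrm{Cay}(\mathrm{Dic}(A,y),S)^D$ is integral and $S_2^D=(S_2^D)^{-1}$. Furthermore, if $1\in D$, then $\mathrm{Cay}(\mathrm{Dic}(A,y),S)^D$ is connected.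
   Context: The Cayley graph $\mathrm{Cay}(G,S)$ has vertex set $G$ and edges $\{g,h\}$ with $g^{-1}h\in S$; it is connected iff $\langle S\rangle=G$. A graph is integral if all eigenvalues of its adjacency matrix are integers. For a connected graph $\Gamma$ and a non-empty finite set $D$ of positive integers, the distance power $\Gamma^D$ has the same vertices as $\Gamma$, two distinct vertices $v,w$ being adjacent iff the graph distance $d_\Gamma(v,w)\in D$. For a finite abelian group $A$, $B(A)$ is the collection of all subsets of $A$ obtained from subgroups of $A$ by finitely many intersections, unions and complements. *)

theory Defs
  imports
    "HOL-Algebra.Multiplicative_Group"
    "HOL-Algebra.Generated_Groups"
    "HOL-Library.Extended_Nat"
    "Jordan_Normal_Form.Char_Poly"
begin

text \<open>A letter \<^term>\<open>(g, True)\<close> stands for the generator \<^term>\<open>g\<close> and \<^term>\<open>(g, False)\<close>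
  for its formal inverse. A pair \<^term>\<open>(l, r)\<close> in the set of relations stands for \<open>l = r\<close>.\<close>

type_synonym 'g group_word = "('g \<times> bool) list"

definition group_words :: "'g set \<Rightarrow> 'g group_word set" where
  "group_words X = lists (X \<times> UNIV)"

inductive_set presentation_rel ::
  "'g set \<Rightarrow> ('g group_word \<times> 'g group_word) set \<Rightarrow> ('g group_word \<times> 'g group_word) set"
  for X :: "'g set" and R :: "('g group_word \<times> 'g group_word) set" where
  refl: "w \<in> group_words X \<Longrightarrow> (w, w) \<in> presentation_rel X R"
| sym: "(u, v) \<in> presentation_rel X R \<Longrightarrow> (v, u) \<in> presentation_rel X R"
| trans: "(u, v) \<in> presentation_rel X R \<Longrightarrow> (v, w) \<in> presentation_rel X R
    \<Longrightarrow> (u, w) \<in> presentation_rel X R"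
| cancel: "u \<in> group_words X \<Longrightarrow> v \<in> group_words X \<Longrightarrow> g \<in> X
    \<Longrightarrow> (u @ [(g, b), (g, \<not> b)] @ v, u @ v) \<in> presentation_rel X R"
| relation: "u \<in> group_words X \<Longrightarrow> v \<in> group_words X
    \<Longrightarrow> (l, r) \<in> R \<Longrightarrow> l \<in> group_words X \<Longrightarrow> r \<in> group_words X
    \<Longrightarrow> (u @ l @ v, u @ r @ v) \<in> presentation_rel X R"

definition presented_group ::
  "'g set \<Rightarrow> ('g group_word \<times> 'g group_word) set \<Rightarrow> 'g group_word set monoid" where
  "presented_group X R =
     \<lparr>carrier = group_words X // presentation_rel X R,
      monoid.mult = (\<lambda>P Q. presentation_rel X R `` {u @ v |u v. u \<in> P \<and> v \<in> Q}),
      one = presentation_rel X R `` {[]}\<rparr>"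

datatype 'a dic_gen = GenA 'a | GenX

text \<open>The first family of relations is the multiplication table of \<open>A\<close>, which is implicit in
  the notation \<open>\<langle>A, x | x\<^sup>2 = y, x a x\<^sup>-\<^sup>1 = a\<^sup>-\<^sup>1 (a \<in> A)\<rangle>\<close>.\<close>

definition dic_relations ::
  "('a, 'm) monoid_scheme \<Rightarrow> 'a \<Rightarrow> ('a dic_gen group_word \<times> 'a dic_gen group_word) set" where
  "dic_relations A y =
     {([(GenA a, True), (GenA b, True)], [(GenA (a \<otimes>\<^bsub>A\<^esub> b), True)]) |a b.
        a \<in> carrier A \<and> b \<in> carrier A}
   \<union> {([(GenX, True), (GenX, True)], [(GenA y, True)])}
   \<union> {([(GenX, True), (GenA a, True), (GenX, False)], [(GenA a, False)]) |a. a \<in> carrier A}"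

definition dic_gens :: "('a, 'm) monoid_scheme \<Rightarrow> 'a dic_gen set" where
  "dic_gens A = insert GenX (GenA ` carrier A)"

definition Dic :: "('a, 'm) monoid_scheme \<Rightarrow> 'a \<Rightarrow> 'a dic_gen group_word set monoid" where
  "Dic A y = presented_group (dic_gens A) (dic_relations A y)"

text \<open>The group \<open>A\<close> is identified with its image under the canonical map
  \<open>dic_emb A y : A \<rightarrow> Dic(A, y)\<close>, so that \<open>dic_subset A y S\<^sub>1 S\<^sub>2\<close> is \<open>S\<^sub>1 \<union> x S\<^sub>2\<close>.\<close>

definition dic_emb :: "('a, 'm) monoid_scheme \<Rightarrow> 'a \<Rightarrow> 'a \<Rightarrow> 'a dic_gen group_word set" where
  "dic_emb A y a = presentation_rel (dic_gens A) (dic_relations A y) `` {[(GenA a, True)]}"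

definition dic_x :: "('a, 'm) monoid_scheme \<Rightarrow> 'a \<Rightarrow> 'a dic_gen group_word set" where
  "dic_x A y = presentation_rel (dic_gens A) (dic_relations A y) `` {[(GenX, True)]}"

definition dic_subset ::
  "('a, 'm) monoid_scheme \<Rightarrow> 'a \<Rightarrow> 'a set \<Rightarrow> 'a set \<Rightarrow> 'a dic_gen group_word set set" where
  "dic_subset A y S\<^sub>1 S\<^sub>2 = dic_emb A y ` S\<^sub>1 \<union> (dic_x A y <#\<^bsub>Dic A y\<^esub> (dic_emb A y ` S\<^sub>2))"

definition group_exponent :: "('a, 'm) monoid_scheme \<Rightarrow> nat" where
  "group_exponent G = (LEAST n. 0 < n \<and> (\<forall>a\<in>carrier G. a [^]\<^bsub>G\<^esub> n = \<one>\<^bsub>G\<^esub>))"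

inductive_set subgroup_algebra :: "('a, 'm) monoid_scheme \<Rightarrow> 'a set set"
  for A :: "('a, 'm) monoid_scheme" where
  subgroup: "subgroup H A \<Longrightarrow> H \<in> subgroup_algebra A"
| inter: "P \<in> subgroup_algebra A \<Longrightarrow> Q \<in> subgroup_algebra A \<Longrightarrow> P \<inter> Q \<in> subgroup_algebra A"
| union: "P \<in> subgroup_algebra A \<Longrightarrow> Q \<in> subgroup_algebra A \<Longrightarrow> P \<union> Q \<in> subgroup_algebra A"
| compl: "P \<in> subgroup_algebra A \<Longrightarrow> carrier A - P \<in> subgroup_algebra A"

type_synonym 'v graph = "'v set \<times> 'v set set"

definition cayley_graph :: "('a, 'm) monoid_scheme \<Rightarrow> 'a set \<Rightarrow> 'a graph" where
  "cayley_graph G S =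
     (carrier G, {{g, h} |g h. g \<in> carrier G \<and> h \<in> carrier G \<and> inv\<^bsub>G\<^esub> g \<otimes>\<^bsub>G\<^esub> h \<in> S})"

definition walk_betw :: "'v graph \<Rightarrow> 'v \<Rightarrow> 'v list \<Rightarrow> 'v \<Rightarrow> bool" where
  "walk_betw \<Gamma> v p w \<longleftrightarrow> p \<noteq> [] \<and> hd p = v \<and> last p = w \<and> set p \<subseteq> fst \<Gamma> \<and>
     (\<forall>i. Suc i < length p \<longrightarrow> {p ! i, p ! Suc i} \<in> snd \<Gamma>)"

definition connected_graph :: "'v graph \<Rightarrow> bool" where
  "connected_graph \<Gamma> \<longleftrightarrow> fst \<Gamma> \<noteq> {} \<and> (\<forall>v\<in>fst \<Gamma>. \<forall>w\<in>fst \<Gamma>. \<exists>p. walk_betw \<Gamma> v p w)"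

definition graph_dist :: "'v graph \<Rightarrow> 'v \<Rightarrow> 'v \<Rightarrow> enat" where
  "graph_dist \<Gamma> v w = (INF p\<in>{p. walk_betw \<Gamma> v p w}. enat (length p - 1))"

definition distance_power :: "'v graph \<Rightarrow> nat set \<Rightarrow> 'v graph" where
  "distance_power \<Gamma> D =
     (fst \<Gamma>, {{v, w} |v w. v \<in> fst \<Gamma> \<and> w \<in> fst \<Gamma> \<and> v \<noteq> w \<and> graph_dist \<Gamma> v w \<in> enat ` D})"

definition adjacency_matrix :: "'v graph \<Rightarrow> 'v list \<Rightarrow> complex mat" where
  "adjacency_matrix \<Gamma> vs =
     mat (length vs) (length vs) (\<lambda>(i, j). if {vs ! i, vs ! j} \<in> snd \<Gamma> then 1 else 0)"

text \<open>The spectrum does not depend on the enumeration \<open>vs\<close> of the vertices.\<close>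

definition integral_graph :: "'v graph \<Rightarrow> bool" where
  "integral_graph \<Gamma> \<longleftrightarrow> finite (fst \<Gamma>) \<and>
     (\<forall>vs. distinct vs \<and> set vs = fst \<Gamma> \<longrightarrow>
        (\<forall>k. eigenvalue (adjacency_matrix \<Gamma> vs) k \<longrightarrow> k \<in> \<int>))"

end

theory Submission
  imports Defs "HOL-Number_Theory.Cong"
begin

text \<open>Write \<open>G = Dic(A, y)\<close>. For \<open>k\<close> coprime to \<open>|A|\<close> the map \<open>a \<mapsto> a\<^sup>k\<close>, \<open>x a \<mapsto> x a\<^sup>k\<close> is an
  automorphism of \<open>G\<close> (\<open>k\<close> is odd, so it fixes \<open>y\<close>). Sets in \<open>B(A)\<close> are closed under these powers, so
  the automorphisms preserve \<open>S\<close>, hence all spheres of the word metric and their union \<open>S\<^sup>D\<close>.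

  For integrality no characters are needed. A power-closed subset of \<open>A\<close> is an integer combination of
  cyclic subgroups. The right summation operators \<open>f \<mapsto> (g \<mapsto> \<Sum>h\<in>H. f (g h))\<close> over subgroups
  \<open>H\<close> of \<open>A\<close> are multiples of projections with eigenvalues \<open>0\<close> and \<open>|H|\<close>, and they commute with each
  other and with the adjacency operator because \<open>H\<close> is normal in \<open>G\<close>. So every eigenspace contains a
  common eigenfunction \<open>f\<close>, on which summation over \<open>S\<^sub>1\<^sup>D\<close> and \<open>S\<^sub>2\<^sup>D\<close> acts by integers \<open>p\<close> and \<open>q\<close>. If
  \<open>k\<close> is the eigenvalue, then \<open>q f(g x) = (k - p) f(g)\<close>, and \<open>y S\<^sub>2\<^sup>D = S\<^sub>2\<^sup>D\<close> gives
  \<open>q f(g y) = q f(g)\<close>; together \<open>(k - p)\<^sup>2 = q\<^sup>2\<close>.\<close>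

section \<open>Distances in Cayley graphs\<close>

primrec set_power :: "('a, 'm) monoid_scheme \<Rightarrow> 'a set \<Rightarrow> nat \<Rightarrow> 'a set" where
  "set_power G S 0 = {\<one>\<^bsub>G\<^esub>}"
| "set_power G S (Suc n) = set_power G S n <#>\<^bsub>G\<^esub> S"

definition word_sphere :: "('a, 'm) monoid_scheme \<Rightarrow> 'a set \<Rightarrow> nat \<Rightarrow> 'a set" where
  "word_sphere G S d = set_power G S d - (\<Union>j<d. set_power G S j)"

section \<open>Walks and the graph distance\<close>

lemma walk_betw_singleton: "walk_betw \<Gamma> v [u] w \<longleftrightarrow> u = v \<and> u = w \<and> u \<in> fst \<Gamma>"
  by (auto simp: walk_betw_def)

text \<open>Walks are extended at their last vertex because \<open>set_power\<close> multiplies new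
  factors on the right.\<close>

lemma walk_betw_snoc:
  assumes "p \<noteq> []"
  shows "walk_betw \<Gamma> v (p @ [u]) w \<longleftrightarrow>
    u = w \<and> w \<in> fst \<Gamma> \<and> walk_betw \<Gamma> v p (last p) \<and> {last p, w} \<in> snd \<Gamma>"
proof -
  have "(\<forall>i. Suc i < length (p @ [u]) \<longrightarrow> {(p @ [u]) ! i, (p @ [u]) ! Suc i} \<in> snd \<Gamma>) \<longleftrightarrow>
    (\<forall>i. Suc i < length p \<longrightarrow> {p ! i, p ! Suc i} \<in> snd \<Gamma>) \<and> {last p, u} \<in> snd \<Gamma>" (is "?L \<longleftrightarrow> ?R")
  proof
    assume L: ?L
    have "{p ! i, p ! Suc i} \<in> snd \<Gamma>" if "Suc i < length p" for i
      using L[rule_format, of i] that by (simp add: nth_append)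
    moreover have "{last p, u} \<in> snd \<Gamma>"
      using L[rule_format, of "length p - 1"] assms by (simp add: nth_append last_conv_nth)
    ultimately show ?R by blast
  next
    assume R: ?R
    show ?L
    proof (intro allI impI)
      fix i assume i: "Suc i < length (p @ [u])"
      show "{(p @ [u]) ! i, (p @ [u]) ! Suc i} \<in> snd \<Gamma>"
      proof (cases "Suc i < length p")
        case True
        then show ?thesis using R by (simp add: nth_append)
      next
        case False
        then have "i = length p - 1" using i by simp
        then show ?thesis using R assms by (simp add: nth_append last_conv_nth)
      qed
    qed
  qed
  then show ?thesis using assms by (auto simp: walk_betw_def)
qed

text \<open>The distance is an infimum of extended naturals, so a finite value is attained by some
  walk. A walk lists its vertices, hence \<open>Suc d\<close> entries for \<open>d\<close>
  edges.\<close>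

lemma graph_dist_eq_enat_iff:
  "graph_dist \<Gamma> v w = enat d \<longleftrightarrow>
    (\<exists>p. walk_betw \<Gamma> v p w \<and> length p = Suc d) \<and>
    (\<forall>j<d. \<not> (\<exists>p. walk_betw \<Gamma> v p w \<and> length p = Suc j))" (is "_ \<longleftrightarrow> ?W d \<and> ?M")
proof -
  define L where "L = (\<lambda>p. enat (length p - 1)) ` {p. walk_betw \<Gamma> v p w}"
  have mem: "enat j \<in> L \<longleftrightarrow> ?W j" for j
  proof -
    have "walk_betw \<Gamma> v p w \<Longrightarrow> length p = Suc (length p - 1)" for p
      by (auto simp: walk_betw_def)
    then show ?thesis unfolding L_def by (auto simp: image_iff)
  qed
  have dist: "graph_dist \<Gamma> v w = Inf L" by (simp add: graph_dist_def L_def)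
  show ?thesis
  proof
    assume "graph_dist \<Gamma> v w = enat d"
    then have I: "Inf L = enat d" using dist by simp
    \<comment> \<open>The infimum of the empty set is infinity, so a finite distance forces some
      walk to exist.\<close>
    then have "L \<noteq> {}" by (metis Inf_enat_def infinity_ne_i0 enat.distinct(1))
    then have "Inf L \<in> L" by (metis Inf_enat_def LeastI ex_in_conv)
    moreover have "enat j \<notin> L" if "j < d" for j
      using that I by (metis Inf_lower enat_ord_simps(1) not_le)
    ultimately show "?W d \<and> ?M" using I mem by auto
  next
    assume a: "?W d \<and> ?M"
    have "Inf L = enat d"
    proof (rule antisym)
      show "Inf L \<le> enat d" using a mem by (intro Inf_lower) blast
      show "enat d \<le> Inf L"
      proof (rule Inf_greatest)
        fix l assume "l \<in> L"
        then show "enat d \<le> l"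
          using a mem by (cases l) (auto simp: not_le[symmetric])
      qed
    qed
    then show "graph_dist \<Gamma> v w = enat d" using dist by simp
  qed
qed

section \<open>Product sets and spheres of the word metric\<close>

context group
begin

lemma inv_mult_cancel_left [simp]:
  "g \<in> carrier G \<Longrightarrow> h \<in> carrier G \<Longrightarrow> inv g \<otimes> (g \<otimes> h) = h"
  by (simp flip: m_assoc)

lemma mult_inv_cancel_left [simp]:
  "g \<in> carrier G \<Longrightarrow> h \<in> carrier G \<Longrightarrow> g \<otimes> (inv g \<otimes> h) = h"
  by (simp flip: m_assoc)

lemma set_power_closed: "S \<subseteq> carrier G \<Longrightarrow> set_power G S n \<subseteq> carrier G"
  by (induction n) (auto simp: set_mult_def)

lemma set_power_Suc_left:
  assumes "S \<subseteq> carrier G"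
  shows "set_power G S (Suc n) = S <#> set_power G S n"
proof (induction n)
  case 0
  show ?case using assms by (force simp: set_mult_def)
next
  case (Suc n)
  have "set_power G S (Suc (Suc n)) = (S <#> set_power G S n) <#> S"
    using Suc by simp
  also have "\<dots> = S <#> set_power G S (Suc n)"
    using assms set_power_closed[OF assms] by (simp add: set_mult_assoc)
  finally show ?case .
qed

lemma set_inv_eqI:
  assumes "T \<subseteq> carrier G" "\<And>g. g \<in> T \<Longrightarrow> inv g \<in> T"
  shows "set_inv T = T"
proof -
  have "g \<in> set_inv T" if "g \<in> T" for g
    using assms that by (auto simp: SET_INV_def intro!: bexI[of _ "inv g"])
  then show ?thesis using assms by (auto simp: SET_INV_def)
qed

lemma set_inv_eqD: "set_inv T = T \<Longrightarrow> g \<in> T \<Longrightarrow> inv g \<in> T"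
  by (auto simp: SET_INV_def)

text \<open>Inversion reverses a product, so the last factor becomes the first one;
  \<open>set_power_Suc_left\<close> reads the result as a product of the right length again.\<close>

lemma set_power_inv_closed:
  assumes "S \<subseteq> carrier G" "set_inv S = S"
  shows "g \<in> set_power G S n \<Longrightarrow> inv g \<in> set_power G S n"
proof (induction n arbitrary: g)
  case 0
  then show ?case by simp
next
  case (Suc n)
  then obtain h s where hs: "h \<in> set_power G S n" "s \<in> S" "g = h \<otimes> s"
    by (auto simp: set_mult_def)
  then have "inv g = inv s \<otimes> inv h"
    using assms(1) set_power_closed[OF assms(1)] by (auto intro!: inv_mult_group)
  moreover have "inv s \<in> S" using set_inv_eqD[OF assms(2) hs(2)] .
  ultimately show ?case
    using Suc.IH[OF hs(1)] unfolding set_power_Suc_left[OF assms(1)] by (auto simp: set_mult_def)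
qed

lemma word_sphere_subset: "S \<subseteq> carrier G \<Longrightarrow> word_sphere G S d \<subseteq> carrier G"
  using set_power_closed by (auto simp: word_sphere_def)

lemma word_sphere_inv_closed:
  assumes "S \<subseteq> carrier G" "set_inv S = S" "g \<in> word_sphere G S d"
  shows "inv g \<in> word_sphere G S d"
proof -
  have "g \<in> carrier G" using word_sphere_subset assms by blast
  then show ?thesis
    using assms(3) set_power_inv_closed[OF assms(1,2)] unfolding word_sphere_def
    by (metis (no_types, lifting) DiffD1 DiffD2 DiffI UN_iff inv_inv)
qed

lemma one_notin_word_sphere: "d > 0 \<Longrightarrow> \<one> \<notin> word_sphere G S d"
  by (auto simp: word_sphere_def intro!: bexI[of _ 0])

lemma subset_word_sphere_one:
  assumes "S \<subseteq> carrier G" "\<one> \<notin> S"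
  shows "S \<subseteq> word_sphere G S 1"
  using assms by (force simp: word_sphere_def set_mult_def)

text \<open>An edge is an unordered pair; the symmetry of \<open>S\<close> makes the membership
  condition independent of its orientation.\<close>

lemma cayley_edge_iff:
  assumes "set_inv S = S"
  shows "{g, h} \<in> snd (cayley_graph G S) \<longleftrightarrow>
    g \<in> carrier G \<and> h \<in> carrier G \<and> inv g \<otimes> h \<in> S"
proof -
  have "inv h \<otimes> g \<in> S" if "g \<in> carrier G" "h \<in> carrier G" "inv g \<otimes> h \<in> S" for g h
  proof -
    have "inv (inv g \<otimes> h) \<in> S" using set_inv_eqD[OF assms that(3)] .
    then show ?thesis using that by (simp add: inv_mult_group)
  qed
  then show ?thesis by (auto simp: cayley_graph_def doubleton_eq_iff)
qed

text \<open>The labels along a walk with \<open>n\<close> edges from \<open>g\<close> to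
  \<open>h\<close> spell \<open>inv g \<otimes> h\<close> as a product of \<open>n\<close> elements
  of \<open>S\<close>.\<close>

lemma cayley_walk_iff:
  assumes "S \<subseteq> carrier G" "set_inv S = S"
  shows "(\<exists>p. walk_betw (cayley_graph G S) g p h \<and> length p = Suc n) \<longleftrightarrow>
    g \<in> carrier G \<and> h \<in> carrier G \<and> inv g \<otimes> h \<in> set_power G S n"
proof (induction n arbitrary: h)
  case 0
  have "g = h" if "g \<in> carrier G" "h \<in> carrier G" "inv g \<otimes> h = \<one>"
    using that by (metis inv_closed inv_equality inv_inv inv_comm)
  moreover have "(\<exists>p. walk_betw (cayley_graph G S) g p h \<and> length p = Suc 0) \<longleftrightarrow> g = h \<and> g \<in> carrier G"
    by (auto simp: length_Suc_conv walk_betw_singleton cayley_graph_def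
        intro!: exI[of _ "[h]"])
  ultimately show ?case by auto
next
  case (Suc n)
  let ?\<Gamma> = "cayley_graph G S"
  have fst: "fst ?\<Gamma> = carrier G" by (simp add: cayley_graph_def)
  have "(\<exists>p. walk_betw ?\<Gamma> g p h \<and> length p = Suc (Suc n)) \<longleftrightarrow>
    (\<exists>u. (\<exists>p. walk_betw ?\<Gamma> g p u \<and> length p = Suc n) \<and> h \<in> carrier G \<and> {u, h} \<in> snd ?\<Gamma>)"
    (is "?L \<longleftrightarrow> ?R")
  proof
    assume ?L
    then obtain p where p: "walk_betw ?\<Gamma> g p h" "length p = Suc (Suc n)" by blast
    then obtain q u where "p = q @ [u]" "length q = Suc n"
      by (metis length_append_singleton nat.inject rev_exhaust list.size(3) nat.distinct(1))
    moreover from this have "q \<noteq> []" by auto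
    ultimately show ?R using p fst by (auto simp: walk_betw_snoc)
  next
    assume ?R
    then obtain u q where "walk_betw ?\<Gamma> g q u" "length q = Suc n" "h \<in> carrier G" "{u, h} \<in> snd ?\<Gamma>"
      by blast
    moreover from this have "q \<noteq> []" "last q = u" by (auto simp: walk_betw_def)
    ultimately have "walk_betw ?\<Gamma> g (q @ [h]) h \<and> length (q @ [h]) = Suc (Suc n)"
      using fst by (simp add: walk_betw_snoc)
    then show ?L by blast
  qed
  also have "\<dots> \<longleftrightarrow> (\<exists>u. g \<in> carrier G \<and> u \<in> carrier G \<and> inv g \<otimes> u \<in> set_power G S n \<and>
    h \<in> carrier G \<and> inv u \<otimes> h \<in> S)"
    unfolding Suc.IH cayley_edge_iff[OF assms(2)] by blast
  also have "\<dots> \<longleftrightarrow> g \<in> carrier G \<and> h \<in> carrier G \<and> inv g \<otimes> h \<in> set_power G S (Suc n)"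
    (is "?L \<longleftrightarrow> ?R")
  proof
    assume ?L
    then obtain u where u: "g \<in> carrier G" "u \<in> carrier G" "inv g \<otimes> u \<in> set_power G S n"
      "h \<in> carrier G" "inv u \<otimes> h \<in> S" by blast
    then have "inv g \<otimes> h = (inv g \<otimes> u) \<otimes> (inv u \<otimes> h)"
      by (simp add: m_assoc)
    then show ?R using u by (auto simp: set_mult_def)
  next
    assume R: ?R
    then obtain w s where ws: "w \<in> set_power G S n" "s \<in> S" "inv g \<otimes> h = w \<otimes> s"
      by (auto simp: set_mult_def)
    then have c: "w \<in> carrier G" "s \<in> carrier G" using assms(1) set_power_closed by auto
    have "h = g \<otimes> (w \<otimes> s)" using R c by (simp add: ws(3)[symmetric])
    then have "inv (g \<otimes> w) \<otimes> h = s" "inv g \<otimes> (g \<otimes> w) = w"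
      using R c by (auto simp: m_assoc inv_mult_group)
    \<comment> \<open>The vertex before \<open>h\<close> is recovered from the first
      \<open>n\<close> factors \<open>w\<close>, starting at \<open>g\<close>.\<close>
    then show ?L using R c ws by (intro exI[of _ "g \<otimes> w"]) auto
  qed
  finally show ?case .
qed

text \<open>Left translations preserve distances, so adjacency in the power depends only on
  \<open>inv g \<otimes> h\<close>; its connection set is the union of the spheres with radius in
  \<open>D\<close>.\<close>

lemma distance_power_cayley_graph:
  assumes "S \<subseteq> carrier G" "set_inv S = S" "\<forall>d\<in>D. d > 0"
  shows "distance_power (cayley_graph G S) D = cayley_graph G (\<Union>d\<in>D. word_sphere G S d)"
proof -
  have dist: "graph_dist (cayley_graph G S) g h \<in> enat ` D \<longleftrightarrow>
      inv g \<otimes> h \<in> (\<Union>d\<in>D. word_sphere G S d)"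
    if "g \<in> carrier G" "h \<in> carrier G" for g h
  proof -
    have "graph_dist (cayley_graph G S) g h = enat d \<longleftrightarrow> inv g \<otimes> h \<in> word_sphere G S d" for d
      unfolding graph_dist_eq_enat_iff cayley_walk_iff[OF assms(1,2)] word_sphere_def
      using that by auto
    then show ?thesis by (auto simp: image_iff)
  qed
  \<comment> \<open>Radii are positive, so the identity is in none of the spheres and the condition
    \<open>v \<noteq> w\<close> of the distance power holds automatically.\<close>
  have "g \<noteq> h" if "g \<in> carrier G" "inv g \<otimes> h \<in> (\<Union>d\<in>D. word_sphere G S d)" for g h
    using that one_notin_word_sphere assms(3) by auto
  then have "{{v, w} |v w. v \<in> carrier G \<and> w \<in> carrier G \<and> v \<noteq> w \<and>
        graph_dist (cayley_graph G S) v w \<in> enat ` D} =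
      {{g, h} |g h. g \<in> carrier G \<and> h \<in> carrier G \<and> inv g \<otimes> h \<in> (\<Union>d\<in>D. word_sphere G S d)}"
    using dist by (intro Collect_cong ex_cong1) metis
  then show ?thesis
    unfolding distance_power_def by (simp add: cayley_graph_def)
qed

text \<open>Inverses of elements of \<open>S\<close> lie in \<open>S\<close> again, so every element
  of the generated subgroup is a plain product of elements of \<open>S\<close>.\<close>

lemma generate_subset_set_power:
  assumes "S \<subseteq> carrier G" "set_inv S = S"
  shows "generate G S \<subseteq> (\<Union>n. set_power G S n)"
proof
  have S1: "s \<in> set_power G S 1" if "s \<in> S" for s
    using that assms(1) by (force simp: set_mult_def)
  have mult: "g \<otimes> h \<in> set_power G S (m + n)"
    if "g \<in> set_power G S m" "h \<in> set_power G S n" for g h m n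
    using that(2)
  proof (induction n arbitrary: h)
    case 0
    then show ?case using that(1) set_power_closed[OF assms(1), of m] by auto
  next
    case (Suc n)
    then obtain w s where "w \<in> set_power G S n" "s \<in> S" "h = w \<otimes> s"
      by (auto simp: set_mult_def)
    moreover have "g \<otimes> (w \<otimes> s) = (g \<otimes> w) \<otimes> s"
      using calculation that(1) assms(1) set_power_closed[OF assms(1)] by (metis m_assoc subsetD)
    ultimately show ?case using Suc.IH by (auto simp: set_mult_def)
  qed
  fix g assume "g \<in> generate G S"
  then show "g \<in> (\<Union>n. set_power G S n)"
  proof (induction rule: generate.induct)
    case one
    show ?case by (auto intro!: exI[of _ 0])
  next
    case (incl h)
    then show ?case using S1 by blast
  next
    case (inv h)
    then show ?case using S1 set_inv_eqD[OF assms(2)] by blast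
  next
    case (eng h1 h2)
    then show ?case using mult by blast
  qed
qed

lemma connected_cayley_graph:
  assumes "S \<subseteq> carrier G" "set_inv S = S" "generate G S = carrier G"
  shows "connected_graph (cayley_graph G S)"
proof -
  have "\<exists>p. walk_betw (cayley_graph G S) g p h" if "g \<in> carrier G" "h \<in> carrier G" for g h
  proof -
    have "inv g \<otimes> h \<in> generate G S" using that assms(3) by simp
    then obtain n where "inv g \<otimes> h \<in> set_power G S n"
      using generate_subset_set_power[OF assms(1,2)] by blast
    then show ?thesis using cayley_walk_iff[OF assms(1,2)] that by blast
  qed
  then show ?thesis by (auto simp: connected_graph_def cayley_graph_def)
qed

end

section \<open>Extensions by an inverting element\<close>

text \<open>A unit modulo \<open>m\<close> is represented by a number coprime to \<open>n\<close>.
  This replaces an exponent that is coprime only to the order of an element by one coprime to the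
  order of the whole group.\<close>

lemma coprime_lift:
  fixes k m n :: nat
  assumes "coprime k m" "n > 0"
  obtains l where "[l = k] (mod m)" "coprime l n"
proof
  \<comment> \<open>With this \<open>q\<close>, each prime factor of \<open>n\<close> divides
    exactly one of \<open>k\<close> and \<open>m * q\<close>, so none divides their sum.\<close>
  define q where "q = (\<Prod>p\<in>{p \<in> prime_factors n. \<not> p dvd k}. p)"
  show "[k + m * q = k] (mod m)" by (simp add: cong_def)
  show "coprime (k + m * q) n"
  proof (rule ccontr)
    assume "\<not> coprime (k + m * q) n"
    then obtain p where p: "prime p" "p dvd k + m * q" "p dvd n"
      by (metis coprime_iff_gcd_eq_1 gcd_greatest_iff prime_factor_nat dvd_refl)
    show False
    proof (cases "p dvd k")
      case True
      then have "p dvd m * q" using p(2) by (simp add: dvd_add_right_iff)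
      moreover have "\<not> p dvd m" using True assms(1) p(1)
        by (meson coprime_common_divisor not_prime_unit)
      ultimately have "p dvd q" using p(1) prime_dvd_multD by blast
      then obtain r where "r \<in> prime_factors n" "\<not> r dvd k" "p dvd r"
        unfolding q_def using p(1) by (auto simp: prime_dvd_prod_iff)
      then show False using True p(1) by (metis in_prime_factors_imp_prime primes_dvd_imp_eq)
    next
      case False
      then have "p dvd q" unfolding q_def using p assms(2)
        by (intro dvd_prodI) (auto simp: prime_factors_dvd)
      then have "p dvd k" using p(2) by (simp add: dvd_add_left_iff)
      then show False using False by blast
    qed
  qed
qed

lemma (in group) pow_eq_iff_cong:
  assumes "a \<in> carrier G"
  shows "a [^] (k::nat) = a [^] (l::nat) \<longleftrightarrow> [k = l] (mod ord a)"
  using int_pow_eq[OF assms, of "int k" "int l"]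
  by (simp add: int_pow_int cong_iff_dvd_diff dvd_diff_commute flip: cong_int_iff)

definition right_sum_eigen ::
  "('a, 'm) monoid_scheme \<Rightarrow> 'a set \<Rightarrow> complex \<Rightarrow> ('a \<Rightarrow> complex) \<Rightarrow> bool" where
  "right_sum_eigen G T k f \<longleftrightarrow> (\<forall>g\<in>carrier G. (\<Sum>s\<in>T. f (g \<otimes>\<^bsub>G\<^esub> s)) = k * f g)"

text \<open>These are the properties of \<open>Dic(A, y)\<close> that the spectral argument uses,
  with \<open>N\<close> the image of \<open>A\<close>; this keeps the argument free of words and
  presentations. Evenness of \<open>card N\<close> forces exponents coprime to it to be odd.\<close>

locale inverting_extension = group G for G (structure) +
  fixes N :: "'a set" and x :: 'a
  assumes subgroup_N: "subgroup N G"
    and finite_N: "finite N"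
    and even_card_N: "even (card N)"
    and N_comm: "\<And>a b. a \<in> N \<Longrightarrow> b \<in> N \<Longrightarrow> a \<otimes> b = b \<otimes> a"
    and x_closed [simp]: "x \<in> carrier G"
    and x_notin: "x \<notin> N"
    and carrier_split: "carrier G = N \<union> (x <# N)"
    and x_inverts: "\<And>a. a \<in> N \<Longrightarrow> x \<otimes> a \<otimes> inv x = inv a"
    and x_square: "x \<otimes> x \<in> N"
begin

lemma N_closed [simp]: "a \<in> N \<Longrightarrow> a \<in> carrier G"
  using subgroup.subset[OF subgroup_N] by blast

lemma N_mult [simp]: "a \<in> N \<Longrightarrow> b \<in> N \<Longrightarrow> a \<otimes> b \<in> N"
  using subgroup.m_closed[OF subgroup_N] .

lemma N_inv [simp]: "a \<in> N \<Longrightarrow> inv a \<in> N"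
  using subgroup.m_inv_closed[OF subgroup_N] .

lemma N_pow [simp]: "a \<in> N \<Longrightarrow> a [^] (k::nat) \<in> N"
  using subgroup.one_closed[OF subgroup_N] by (induction k) auto

lemma x_mult_notin [simp]: "a \<in> N \<Longrightarrow> x \<otimes> a \<notin> N"
proof
  assume a: "a \<in> N" "x \<otimes> a \<in> N"
  then have "x \<otimes> a \<otimes> inv a \<in> N" using N_mult[OF a(2) N_inv[OF a(1)]] by simp
  then show False using a x_notin by (simp add: m_assoc)
qed

lemma carrier_cases:
  assumes "g \<in> carrier G"
  obtains "g \<in> N" | a where "a \<in> N" "g = x \<otimes> a"
  using assms carrier_split by (auto simp: l_coset_def)

lemma finite_carrier: "finite (carrier G)"
  using finite_N carrier_split by (simp add: l_coset_def)

lemma mult_x: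
  assumes "a \<in> N"
  shows "a \<otimes> x = x \<otimes> inv a"
proof -
  have "a = x \<otimes> inv a \<otimes> inv x" using x_inverts[of "inv a"] assms by simp
  then have "a \<otimes> x = x \<otimes> inv a \<otimes> inv x \<otimes> x" by simp
  then show ?thesis using assms by (simp add: m_assoc)
qed

lemma mult_x_assoc:
  assumes "a \<in> N" "g \<in> carrier G"
  shows "a \<otimes> (x \<otimes> g) = x \<otimes> (inv a \<otimes> g)"
  using mult_x[OF assms(1)] assms by (metis N_closed inv_closed m_assoc x_closed)

lemma x_mult_x_mult:
  assumes "a \<in> N" "b \<in> N"
  shows "x \<otimes> a \<otimes> (x \<otimes> b) = x \<otimes> x \<otimes> (inv a \<otimes> b)"
  using assms by (simp add: m_assoc mult_x_assoc)

text \<open>Conjugation by \<open>x\<close> fixes \<open>x \<otimes> x\<close>, yet inverts it as an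
  element of \<open>N\<close>.\<close>

lemma inv_x_square: "inv (x \<otimes> x) = x \<otimes> x"
  using x_inverts[OF x_square] by (simp add: m_assoc)

lemma x_square_square: "x \<otimes> x \<otimes> (x \<otimes> x) = \<one>"
  using inv_x_square by (metis m_closed r_inv x_closed)

lemma x_square_pow:
  assumes "odd k"
  shows "(x \<otimes> x) [^] (k::nat) = x \<otimes> x"
proof -
  have "(x \<otimes> x) [^] (2::nat) = \<one>" using x_square_square by (simp add: numeral_2_eq_2)
  then have "(x \<otimes> x) [^] (2 * j) = \<one>" for j :: nat
    by (metis m_closed nat_pow_one nat_pow_pow x_closed)
  then show ?thesis using assms by (auto elim!: oddE)
qed

text \<open>On the coset \<open>x N\<close>, inversion is multiplication of the
  \<open>N\<close>-coordinate by the square of \<open>x\<close>. This is why a symmetric set has a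
  second part stable under that square.\<close>

lemma inv_x_mult:
  assumes "a \<in> N"
  shows "inv (x \<otimes> a) = x \<otimes> (x \<otimes> x \<otimes> a)"
proof (rule inv_equality)
  let ?y = "x \<otimes> x"
  have "inv (?y \<otimes> a) = ?y \<otimes> inv a"
    using assms x_square N_comm[of ?y "inv a"] inv_x_square by (simp add: inv_mult_group[of ?y a])
  then have "x \<otimes> (?y \<otimes> a) \<otimes> (x \<otimes> a) = ?y \<otimes> (?y \<otimes> inv a \<otimes> a)"
    using x_mult_x_mult[of "?y \<otimes> a" a] assms x_square by simp
  also have "\<dots> = ?y \<otimes> ?y"
    using assms by (simp add: m_assoc)
  finally show "x \<otimes> (?y \<otimes> a) \<otimes> (x \<otimes> a) = \<one>" using x_square_square by simp
qed (use assms in auto)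

lemma pow_card_N: "a \<in> N \<Longrightarrow> a [^] card N = \<one>"
proof -
  assume a: "a \<in> N"
  interpret N: group "G\<lparr>carrier := N\<rparr>"
    using subgroup_imp_group[OF subgroup_N] .
  have "a [^]\<^bsub>G\<lparr>carrier := N\<rparr>\<^esub> card N = \<one>"
    using N.pow_order_eq_1[of a] a by (simp add: Coset.order_def)
  then show ?thesis using nat_pow_consistent by metis
qed

lemma pow_cong:
  assumes "a \<in> N" "[k = l] (mod card N)"
  shows "a [^] k = a [^] l"
proof -
  have "a [^] k = a [^] (k mod card N)" for k :: nat
  proof -
    have "a [^] k = a [^] (card N * (k div card N) + k mod card N)" by simp
    also have "\<dots> = (a [^] card N) [^] (k div card N) \<otimes> a [^] (k mod card N)"
      using assms(1) by (simp add: nat_pow_mult nat_pow_pow del: mult_div_mod_eq)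
    finally show ?thesis using assms(1) by (simp add: pow_card_N)
  qed
  then show ?thesis using assms(2) unfolding cong_def by metis
qed

section \<open>Power automorphisms and the sets they preserve\<close>

text \<open>For \<open>g\<close> in \<open>x N\<close>, the factor \<open>inv x \<otimes> g\<close>
  is the \<open>N\<close>-coordinate of \<open>g\<close>.\<close>

definition power_aut :: "nat \<Rightarrow> 'a \<Rightarrow> 'a" where
  "power_aut k g = (if g \<in> N then g [^] k else x \<otimes> (inv x \<otimes> g) [^] k)"

lemma power_aut_N [simp]: "a \<in> N \<Longrightarrow> power_aut k a = a [^] k"
  by (simp add: power_aut_def)

lemma power_aut_x [simp]: "a \<in> N \<Longrightarrow> power_aut k (x \<otimes> a) = x \<otimes> a [^] k"
  by (simp add: power_aut_def)

lemma N_pow_mult: "a \<in> N \<Longrightarrow> b \<in> N \<Longrightarrow> (a \<otimes> b) [^] (k::nat) = a [^] k \<otimes> b [^] k"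
  by (simp add: pow_mult_distrib N_comm)

text \<open>The only delicate case is a product of two elements of \<open>x N\<close>: it produces a
  factor \<open>x \<otimes> x\<close>, which odd powers fix.\<close>

lemma power_aut_mult:
  assumes "odd k" "g \<in> carrier G" "h \<in> carrier G"
  shows "power_aut k (g \<otimes> h) = power_aut k g \<otimes> power_aut k h"
proof (rule carrier_cases[OF assms(2)])
  assume g: "g \<in> N"
  show ?thesis
    by (rule carrier_cases[OF assms(3)])
       (use g in \<open>auto simp: N_pow_mult mult_x_assoc nat_pow_inv\<close>)
next
  fix a assume a: "a \<in> N" "g = x \<otimes> a"
  show ?thesis
  proof (rule carrier_cases[OF assms(3)])
    assume "h \<in> N"
    then show ?thesis using a by (simp add: N_pow_mult m_assoc)
  next
    fix b assume "b \<in> N" "h = x \<otimes> b"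
    then show ?thesis using a x_square assms(1)
      by (simp add: x_mult_x_mult N_pow_mult nat_pow_inv x_square_pow)
  qed
qed

lemma power_aut_left_inverse:
  assumes "[k * l = 1] (mod card N)" "g \<in> carrier G"
  shows "power_aut l (power_aut k g) = g"
proof -
  have "(a [^] k) [^] l = a" if "a \<in> N" for a
    using pow_cong[OF that assms(1)] that by (simp add: nat_pow_pow)
  then show ?thesis using assms(2) by (auto elim!: carrier_cases)
qed

definition power_invariant :: "'a set \<Rightarrow> bool" where
  "power_invariant T \<longleftrightarrow> T \<subseteq> carrier G \<and>
    (\<forall>k. coprime k (card N) \<longrightarrow> (\<forall>g\<in>T. power_aut k g \<in> T))"

lemma coprime_card_N_odd: "coprime k (card N) \<Longrightarrow> odd k"
  using even_card_N by (meson coprime_common_divisor odd_one)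

lemma power_invariant_set_mult:
  assumes "power_invariant T" "power_invariant U"
  shows "power_invariant (T <#> U)"
  unfolding power_invariant_def
proof (intro conjI allI impI ballI)
  show "T <#> U \<subseteq> carrier G"
    using assms by (intro set_mult_closed) (auto simp: power_invariant_def)
  fix k g assume k: "coprime k (card N)" and "g \<in> T <#> U"
  then obtain t u where tu: "t \<in> T" "u \<in> U" "g = t \<otimes> u" by (auto simp: set_mult_def)
  then have "power_aut k g = power_aut k t \<otimes> power_aut k u"
    using assms coprime_card_N_odd[OF k] by (auto intro!: power_aut_mult simp: power_invariant_def)
  moreover have "power_aut k t \<in> T" "power_aut k u \<in> U"
    using assms k tu by (auto simp: power_invariant_def)
  ultimately show "power_aut k g \<in> T <#> U" by (auto simp: set_mult_def)
qed

text \<open>An exponent \<open>l\<close> inverse to \<open>k\<close> modulo \<open>card N\<close> is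
  coprime to \<open>card N\<close> too, so if the image of \<open>g\<close> under
  \<open>power_aut k\<close> lay in \<open>U\<close>, then \<open>power_aut l\<close> would bring
  \<open>g\<close> itself into \<open>U\<close>.\<close>

lemma power_invariant_Diff:
  assumes "power_invariant T" "power_invariant U"
  shows "power_invariant (T - U)"
proof -
  have "power_aut k g \<notin> U" if k: "coprime k (card N)" and g: "g \<in> T" "g \<notin> U" for k g
  proof
    assume a: "power_aut k g \<in> U"
    obtain l where l: "[k * l = 1] (mod card N)" using cong_solve_coprime_nat[OF k] by auto
    then have "coprime l (card N)" using coprime_iff_invertible_nat[of l] by (auto simp: mult.commute)
    then have "power_aut l (power_aut k g) \<in> U" using assms(2) a by (auto simp: power_invariant_def)
    moreover have "g \<in> carrier G" using assms(1) g by (auto simp: power_invariant_def)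
    ultimately show False using power_aut_left_inverse[OF l] g by simp
  qed
  then show ?thesis using assms(1) by (auto simp: power_invariant_def)
qed

lemma power_invariant_UN: "(\<And>i. i \<in> I \<Longrightarrow> power_invariant (T i)) \<Longrightarrow> power_invariant (\<Union>i\<in>I. T i)"
  unfolding power_invariant_def by blast

lemma power_invariant_word_sphere:
  assumes "power_invariant S"
  shows "power_invariant (word_sphere G S d)"
proof -
  have "power_invariant {\<one>}"
    using subgroup.one_closed[OF subgroup_N] by (simp add: power_invariant_def)
  then have "power_invariant (set_power G S n)" for n
    by (induction n) (auto intro: power_invariant_set_mult assms)
  then show ?thesis
    unfolding word_sphere_def by (intro power_invariant_Diff power_invariant_UN)
qed

lemma power_invariantI:
  assumes "T\<^sub>1 \<subseteq> N" "T\<^sub>2 \<subseteq> N"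
    and "\<And>k a. coprime k (card N) \<Longrightarrow> a \<in> T\<^sub>1 \<Longrightarrow> a [^] k \<in> T\<^sub>1"
    and "\<And>k a. coprime k (card N) \<Longrightarrow> a \<in> T\<^sub>2 \<Longrightarrow> a [^] k \<in> T\<^sub>2"
  shows "power_invariant (T\<^sub>1 \<union> (x <# T\<^sub>2))"
proof -
  have "power_aut k (x \<otimes> b) = x \<otimes> b [^] k" if "b \<in> T\<^sub>2" for k b
    using assms(2) that by auto
  moreover have "power_aut k a = a [^] k" if "a \<in> T\<^sub>1" for k a
    using assms(1) that by auto
  moreover have "T\<^sub>1 \<union> (x <# T\<^sub>2) \<subseteq> carrier G"
    using assms(1,2) by (auto simp: l_coset_def)
  ultimately show ?thesis
    unfolding power_invariant_def using assms(3,4) by (auto simp: l_coset_def)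
qed

section \<open>Integrality\<close>

text \<open>This is normality of \<open>H\<close> in the form \<open>u H = H u\<close>: elements of
  \<open>N\<close> centralise \<open>H\<close>, and elements of \<open>x N\<close> act on it by
  inversion, which permutes \<open>H\<close>.\<close>

lemma sum_subgroup_swap:
  fixes f :: "'a \<Rightarrow> complex"
  assumes H: "subgroup H G" "H \<subseteq> N" and gu: "g \<in> carrier G" "u \<in> carrier G"
  shows "(\<Sum>h\<in>H. f (g \<otimes> u \<otimes> h)) = (\<Sum>h\<in>H. f (g \<otimes> h \<otimes> u))"
proof (rule carrier_cases[OF gu(2)])
  assume "u \<in> N"
  then have "g \<otimes> u \<otimes> h = g \<otimes> h \<otimes> u" if "h \<in> H" for h
    using that H(2) gu N_comm[of u h] by (auto simp: m_assoc)
  then show ?thesis by simp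
next
  fix a assume a: "a \<in> N" "u = x \<otimes> a"
  have inv: "inv h \<in> H" if "h \<in> H" for h using subgroup.m_inv_closed[OF H(1) that] .
  show ?thesis
  proof (rule sum.reindex_bij_witness[of _ "\<lambda>h. inv h" "\<lambda>h. inv h"])
    fix h assume h: "h \<in> H"
    then have hN: "h \<in> N" using H(2) by blast
    show "inv h \<in> H" "inv (inv h) = h" using h hN inv by auto
    then show "inv h \<in> H" "inv (inv h) = h" .
    have "inv h \<otimes> (x \<otimes> a) = x \<otimes> (h \<otimes> a)" using hN a by (simp add: mult_x_assoc)
    then show "f (g \<otimes> inv h \<otimes> u) = f (g \<otimes> u \<otimes> h)"
      using hN a gu N_comm[of h a] by (simp add: m_assoc)
  qed
qed

text \<open>Summation over \<open>H\<close> commutes with summation over \<open>U\<close>, so it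
  preserves the eigenspaces of the latter.\<close>

lemma right_sum_eigen_average:
  assumes H: "subgroup H G" "H \<subseteq> N" and U: "U \<subseteq> carrier G" "right_sum_eigen G U c f"
  shows "right_sum_eigen G U c (\<lambda>g. \<Sum>h\<in>H. f (g \<otimes> h))"
  unfolding right_sum_eigen_def
proof
  fix g assume g: "g \<in> carrier G"
  have Hc: "h \<in> carrier G" if "h \<in> H" for h using that H(2) by auto
  have "(\<Sum>u\<in>U. \<Sum>h\<in>H. f (g \<otimes> u \<otimes> h)) = (\<Sum>u\<in>U. \<Sum>h\<in>H. f (g \<otimes> h \<otimes> u))"
    using U(1) by (intro sum.cong HOL.refl sum_subgroup_swap H g) auto
  also have "\<dots> = (\<Sum>h\<in>H. \<Sum>u\<in>U. f (g \<otimes> h \<otimes> u))" by (rule sum.swap)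
  also have "\<dots> = (\<Sum>h\<in>H. c * f (g \<otimes> h))"
  proof (rule sum.cong[OF HOL.refl])
    fix h assume "h \<in> H"
    then show "(\<Sum>u\<in>U. f (g \<otimes> h \<otimes> u)) = c * f (g \<otimes> h)"
      using bspec[OF U(2)[unfolded right_sum_eigen_def], of "g \<otimes> h"] g Hc by simp
  qed
  finally show "(\<Sum>u\<in>U. \<Sum>h\<in>H. f (g \<otimes> u \<otimes> h)) = c * (\<Sum>h\<in>H. f (g \<otimes> h))"
    by (simp add: sum_distrib_left)
qed

text \<open>The averaged function is constant on each coset \<open>g H\<close>, since translation by
  an element of \<open>H\<close> permutes \<open>H\<close>.\<close>

lemma right_sum_eigen_average_self:
  assumes H: "subgroup H G" "H \<subseteq> N"
  shows "right_sum_eigen G H (of_nat (card H)) (\<lambda>g. \<Sum>h\<in>H. f (g \<otimes> h))"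
  unfolding right_sum_eigen_def
proof
  fix g assume g: "g \<in> carrier G"
  have Hc: "h \<in> carrier G" if "h \<in> H" for h using that H(2) by auto
  have "(\<Sum>h\<in>H. f (g \<otimes> k \<otimes> h)) = (\<Sum>h\<in>H. f (g \<otimes> h))" if k: "k \<in> H" for k
    by (rule sum.reindex_bij_witness[of _ "\<lambda>h. inv k \<otimes> h" "\<lambda>h. k \<otimes> h"])
       (use k g Hc H(1) in \<open>auto simp: m_assoc subgroup.m_closed subgroup.m_inv_closed\<close>)
  then show "(\<Sum>k\<in>H. \<Sum>h\<in>H. f (g \<otimes> k \<otimes> h)) = of_nat (card H) * (\<Sum>h\<in>H. f (g \<otimes> h))"
    by simp
qed

text \<open>Subgroups are treated one at a time. If the sum over \<open>H\<close> does not
  annihilate the current function, the summed function has eigenvalue \<open>card H\<close> and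
  keeps all earlier eigenvalues; otherwise the current function already has eigenvalue 0 for
  \<open>H\<close>.\<close>

lemma common_eigenfunction:
  assumes "finite \<H>" "\<And>H. H \<in> \<H> \<Longrightarrow> subgroup H G \<and> H \<subseteq> N"
    and "T \<subseteq> carrier G" "right_sum_eigen G T k f" "\<exists>g\<in>carrier G. f g \<noteq> 0"
  shows "\<exists>f'. right_sum_eigen G T k f' \<and> (\<exists>g\<in>carrier G. f' g \<noteq> 0) \<and>
    (\<forall>H\<in>\<H>. \<exists>c::int. right_sum_eigen G H (of_int c) f')"
  using assms(1,2)
proof (induction \<H> rule: finite_induct)
  case empty
  show ?case using assms(4,5) by (intro exI[of _ f]) simp
next
  case (insert H \<H>)
  then have "\<exists>f'. right_sum_eigen G T k f' \<and> (\<exists>g\<in>carrier G. f' g \<noteq> 0) \<and>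
    (\<forall>H\<in>\<H>. \<exists>c::int. right_sum_eigen G H (of_int c) f')" by simp
  then obtain f' where f': "right_sum_eigen G T k f'" "\<exists>g\<in>carrier G. f' g \<noteq> 0"
      "\<forall>K\<in>\<H>. \<exists>c::int. right_sum_eigen G K (of_int c) f'" by (elim exE conjE)
  have H: "subgroup H G" "H \<subseteq> N" using insert.prems by auto
  define F where "F = (\<lambda>g. \<Sum>h\<in>H. f' (g \<otimes> h))"
  show ?case
  proof (cases "\<exists>g\<in>carrier G. F g \<noteq> 0")
    case True
    have "right_sum_eigen G T k F"
      unfolding F_def using right_sum_eigen_average[OF H assms(3) f'(1)] .
    moreover have "right_sum_eigen G H (of_int (int (card H))) F"
      unfolding F_def using right_sum_eigen_average_self[OF H, of f'] by simp
    moreover have "\<exists>c::int. right_sum_eigen G K (of_int c) F" if "K \<in> \<H>" for K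
    proof -
      have "K \<subseteq> carrier G" using insert.prems[of K] that N_closed by blast
      then show ?thesis
        unfolding F_def using bspec[OF f'(3) that] right_sum_eigen_average[OF H] by blast
    qed
    ultimately show ?thesis using True by (intro exI[of _ F]) blast
  next
    case False
    then have "right_sum_eigen G H (of_int 0) f'"
      by (simp add: right_sum_eigen_def F_def)
    then show ?thesis using f' by (intro exI[of _ f']) blast
  qed
qed

section \<open>Classes of generators of cyclic subgroups\<close>

text \<open>These are the classes of an equivalence relation on \<open>N\<close>; power-closed
  subsets of \<open>N\<close> are unions of them.\<close>

definition cyclic_class :: "'a \<Rightarrow> 'a set" where
  "cyclic_class a = {b \<in> N. generate G {b} = generate G {a}}"

lemma right_sum_eigen_Un:
  assumes "right_sum_eigen G T (of_int c) f" "right_sum_eigen G U (of_int d) f"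
    "T \<inter> U = {}" "finite T" "finite U"
  shows "right_sum_eigen G (T \<union> U) (of_int (c + d)) f"
  using assms by (simp add: right_sum_eigen_def sum.union_disjoint distrib_right)

lemma right_sum_eigen_Diff:
  assumes "right_sum_eigen G T (of_int c) f" "right_sum_eigen G U (of_int d) f"
    "U \<subseteq> T" "finite T"
  shows "right_sum_eigen G (T - U) (of_int (c - d)) f"
  using assms by (simp add: right_sum_eigen_def sum_diff left_diff_distrib)

text \<open>Distinct classes are disjoint, so they can be split off one by one and their integer
  eigenvalues add up.\<close>

lemma right_sum_eigen_class_union:
  assumes "T \<subseteq> N" "\<And>a. a \<in> T \<Longrightarrow> cyclic_class a \<subseteq> T"
    and "\<And>a. a \<in> T \<Longrightarrow> \<exists>c::int. right_sum_eigen G (cyclic_class a) (of_int c) f"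
  shows "\<exists>c::int. right_sum_eigen G T (of_int c) f"
proof -
  have "finite T" using assms(1) finite_N finite_subset by blast
  then show ?thesis using assms
  proof (induction T rule: finite_psubset_induct)
    case (psubset T)
    show ?case
    proof (cases "T = {}")
      case True
      then show ?thesis by (auto simp: right_sum_eigen_def intro!: exI[of _ 0])
    next
      case False
      then obtain a where a: "a \<in> T" by blast
      let ?U = "T - cyclic_class a"
      have "a \<in> cyclic_class a" using a psubset.prems(1) by (auto simp: cyclic_class_def)
      then have "?U \<subset> T" using a by blast
      moreover have "cyclic_class b \<subseteq> ?U" if "b \<in> ?U" for b
        using that psubset.prems(1,2) by (auto simp: cyclic_class_def)
      ultimately obtain c :: int where c: "right_sum_eigen G ?U (of_int c) f"
        using psubset.IH[of ?U] psubset.prems by blast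
      obtain d :: int where d: "right_sum_eigen G (cyclic_class a) (of_int d) f"
        using psubset.prems(3)[OF a] by blast
      have "?U \<union> cyclic_class a = T" using psubset.prems(2)[OF a] by blast
      then show ?thesis
        using right_sum_eigen_Un[OF c d] psubset.hyps psubset.prems(2)[OF a]
        by (metis Diff_disjoint finite_Diff finite_subset inf_commute)
    qed
  qed
qed

lemma generate_subset_N: "a \<in> N \<Longrightarrow> generate G {a} \<subseteq> N"
  using generate_subgroup_incl[OF _ subgroup_N, of "{a}"] by simp

lemma generate_singleton_subgroup: "a \<in> N \<Longrightarrow> subgroup (generate G {a}) G"
  by (intro generate_is_subgroup) simp

text \<open>The generators of a cyclic group \<open>C\<close> are obtained from \<open>C\<close> by removing the classes of
  generators of the proper subgroups of \<open>C\<close>.\<close>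

lemma right_sum_eigen_cyclic_class:
  assumes "\<And>H. subgroup H G \<Longrightarrow> H \<subseteq> N \<Longrightarrow> \<exists>c::int. right_sum_eigen G H (of_int c) f"
    and "a \<in> N"
  shows "\<exists>c::int. right_sum_eigen G (cyclic_class a) (of_int c) f"
  using assms(2)
proof (induction "card (generate G {a})" arbitrary: a rule: less_induct)
  case less
  let ?C = "generate G {a}" let ?U = "?C - cyclic_class a"
  have CN: "?C \<subseteq> N" using generate_subset_N[OF less.prems] .
  have finC: "finite ?C" using CN finite_N finite_subset by blast
  have sub: "generate G {b} \<subseteq> ?C" if "b \<in> ?C" for b
    using generate_subgroup_incl[OF _ generate_singleton_subgroup[OF less.prems], of "{b}"] that by simp
  have gen: "b \<in> generate G {b}" for b by (simp add: generate.incl)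
  have "cyclic_class a \<subseteq> ?C" using gen by (auto simp: cyclic_class_def)
  then have eq: "?C - ?U = cyclic_class a" by blast
  have "\<exists>c::int. right_sum_eigen G ?U (of_int c) f"
  proof (rule right_sum_eigen_class_union)
    show "?U \<subseteq> N" using CN by blast
    fix b assume b: "b \<in> ?U"
    then have bN: "b \<in> N" using CN by blast
    show "cyclic_class b \<subseteq> ?U"
    proof
      fix c assume c: "c \<in> cyclic_class b"
      then have "c \<in> generate G {b}" using gen[of c] by (simp add: cyclic_class_def)
      then show "c \<in> ?U" using b c sub[of b] bN by (auto simp: cyclic_class_def)
    qed
    have "generate G {b} \<subset> ?C" using b sub[of b] bN by (auto simp: cyclic_class_def)
    then have "card (generate G {b}) < card ?C" using finC by (rule psubset_card_mono[rotated])
    then show "\<exists>c::int. right_sum_eigen G (cyclic_class b) (of_int c) f" using less.hyps bN by blast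
  qed
  moreover have "\<exists>c::int. right_sum_eigen G ?C (of_int c) f"
    using assms(1)[OF generate_singleton_subgroup[OF less.prems] CN] .
  ultimately obtain c d :: int where "right_sum_eigen G ?C (of_int c) f"
    "right_sum_eigen G ?U (of_int d) f" by blast
  then have "right_sum_eigen G (?C - ?U) (of_int (c - d)) f"
    using finC by (intro right_sum_eigen_Diff) auto
  then show ?case unfolding eq by blast
qed

text \<open>Two generators of a finite cyclic group are powers of each other, with exponents inverse
  modulo the order. Hence closure under powers coprime to \<open>card N\<close> implies closure
  under \<open>cyclic_class\<close>.\<close>

lemma cyclic_class_power:
  assumes "a \<in> N" "b \<in> cyclic_class a"
  obtains k where "coprime k (card N)" "b = a [^] k"
proof -
  have pow: "\<exists>k::nat. d = c [^] k" if "c \<in> N" "d \<in> generate G {c}" for c d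
    using generate_pow_nat[of c] that ord_ge_1[OF finite_carrier, of c] by auto
  have b: "b \<in> N" "generate G {b} = generate G {a}" using assms by (auto simp: cyclic_class_def)
  have "b \<in> generate G {a}" "a \<in> generate G {b}"
    using b(2) generate.incl[of b "{b}" G] generate.incl[of a "{a}" G] by auto
  then obtain k l :: nat where kl: "b = a [^] k" "a = b [^] l" using pow assms(1) b(1) by blast
  have "a [^] (k * l) = a" using kl assms(1) by (simp flip: nat_pow_pow)
  then have "[k * l = 1] (mod ord a)"
    using assms(1) pow_eq_iff_cong[of a "k * l" 1] by simp
  then have "coprime k (ord a)" using coprime_iff_invertible_nat[of k "ord a"] by auto
  moreover have "card N > 0" using assms(1) finite_N card_gt_0_iff by blast
  \<comment> \<open>So far \<open>k\<close> is coprime only to the order of \<open>a\<close>;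
    passing to \<open>m\<close> leaves the power of \<open>a\<close> unchanged.\<close>
  ultimately obtain m where m: "[m = k] (mod ord a)" "coprime m (card N)" using coprime_lift by blast
  have "a [^] m = a [^] k" using m(1) assms(1) pow_eq_iff_cong by simp
  then show thesis using that m(2) kl(1) by simp
qed

lemma integer_eigenvalue:
  assumes T: "power_invariant T" "set_inv T = T"
    and f: "right_sum_eigen G T k f" "\<exists>g\<in>carrier G. f g \<noteq> 0"
  shows "k \<in> \<int>"
proof -
  have Tc: "T \<subseteq> carrier G" using T(1) by (simp add: power_invariant_def)
  have "finite {H. subgroup H G \<and> H \<subseteq> N}"
    by (rule finite_subset[of _ "Pow N"]) (use finite_N in auto)
  then have "\<exists>F. right_sum_eigen G T k F \<and> (\<exists>g\<in>carrier G. F g \<noteq> 0) \<and>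
    (\<forall>H\<in>{H. subgroup H G \<and> H \<subseteq> N}. \<exists>c::int. right_sum_eigen G H (of_int c) F)"
    by (rule common_eigenfunction[OF _ _ Tc f]) simp
  then obtain F where
    F: "right_sum_eigen G T k F" "\<exists>g\<in>carrier G. F g \<noteq> 0"
      and FH: "\<forall>H\<in>{H. subgroup H G \<and> H \<subseteq> N}. \<exists>c::int. right_sum_eigen G H (of_int c) F"
    by (elim exE conjE)
  have F_sub: "\<exists>c::int. right_sum_eigen G H (of_int c) F" if "subgroup H G" "H \<subseteq> N" for H
    using bspec[OF FH, of H] that by simp
  \<comment> \<open>The coordinates of \<open>T\<close> in the decomposition of \<open>G\<close>
    into \<open>N\<close> and \<open>x N\<close>.\<close>
  define T\<^sub>1 T\<^sub>2 where "T\<^sub>1 = T \<inter> N" and "T\<^sub>2 = {a \<in> N. x \<otimes> a \<in> T}"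
  \<comment> \<open>Power-closed sets split into cyclic classes, and on \<open>F\<close> each class
    acts by an integer because all subgroups of \<open>N\<close> do.\<close>
  have int: "\<exists>c::int. right_sum_eigen G U (of_int c) F"
    if "U \<subseteq> N" "\<And>j a. coprime j (card N) \<Longrightarrow> a \<in> U \<Longrightarrow> a [^] j \<in> U" for U
  proof (rule right_sum_eigen_class_union[OF that(1)])
    fix a assume a: "a \<in> U"
    then have aN: "a \<in> N" using that(1) by blast
    show "cyclic_class a \<subseteq> U"
      using that(2) a by (blast elim: cyclic_class_power[OF aN])
    show "\<exists>c::int. right_sum_eigen G (cyclic_class a) (of_int c) F"
      by (rule right_sum_eigen_cyclic_class[OF F_sub aN])
  qed
  have "a [^] j \<in> T\<^sub>1" if "coprime j (card N)" "a \<in> T\<^sub>1" for j a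
    using T(1) that unfolding power_invariant_def T\<^sub>1_def by (metis IntE IntI N_pow power_aut_N)
  then obtain p :: int where p: "right_sum_eigen G T\<^sub>1 (of_int p) F"
    using int[of T\<^sub>1] by (auto simp: T\<^sub>1_def)
  have "a [^] j \<in> T\<^sub>2" if "coprime j (card N)" "a \<in> T\<^sub>2" for j a
  proof -
    have "power_aut j (x \<otimes> a) \<in> T" using T(1) that unfolding power_invariant_def T\<^sub>2_def by blast
    then show ?thesis using that by (simp add: T\<^sub>2_def)
  qed
  then obtain q :: int where q: "right_sum_eigen G T\<^sub>2 (of_int q) F"
    using int[of T\<^sub>2] by (auto simp: T\<^sub>2_def)
  let ?y = "x \<otimes> x"
  have yT: "?y \<otimes> a \<in> T\<^sub>2" if "a \<in> T\<^sub>2" for a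
  proof -
    have "inv (x \<otimes> a) \<in> T" using set_inv_eqD[OF T(2)] that by (simp add: T\<^sub>2_def)
    then show ?thesis using that x_square by (simp add: T\<^sub>2_def inv_x_mult)
  qed
  have T_split: "T = T\<^sub>1 \<union> (\<lambda>a. x \<otimes> a) ` T\<^sub>2"
    using Tc by (auto simp: T\<^sub>1_def T\<^sub>2_def elim!: carrier_cases)
  have fin: "finite T\<^sub>1" "finite T\<^sub>2" using finite_N by (auto simp: T\<^sub>1_def T\<^sub>2_def)
  \<comment> \<open>The eigenvalue equation at \<open>g\<close> is split along
    \<open>T\<^sub>1\<close> and \<open>x T\<^sub>2\<close>; the second sum is the
    \<open>T\<^sub>2\<close>-sum based at \<open>g \<otimes> x\<close>.\<close>
  have eq1: "of_int q * F (g \<otimes> x) = (k - of_int p) * F g" if g: "g \<in> carrier G" for g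
  proof -
    have "k * F g = (\<Sum>s\<in>T. F (g \<otimes> s))" using F(1) g by (simp add: right_sum_eigen_def)
    also have "\<dots> = (\<Sum>s\<in>T\<^sub>1. F (g \<otimes> s)) + (\<Sum>s\<in>(\<lambda>a. x \<otimes> a) ` T\<^sub>2. F (g \<otimes> s))"
      unfolding T_split using fin by (intro sum.union_disjoint) (auto simp: T\<^sub>1_def T\<^sub>2_def)
    also have "(\<Sum>s\<in>(\<lambda>a. x \<otimes> a) ` T\<^sub>2. F (g \<otimes> s)) = (\<Sum>a\<in>T\<^sub>2. F (g \<otimes> (x \<otimes> a)))"
      by (intro sum.reindex_cong[where l = "\<lambda>a. x \<otimes> a"]) (auto simp: inj_on_def T\<^sub>2_def)
    also have "\<dots> = (\<Sum>a\<in>T\<^sub>2. F (g \<otimes> x \<otimes> a))"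
      using g by (intro sum.cong) (auto simp: m_assoc T\<^sub>2_def)
    finally show ?thesis using p q g by (simp add: right_sum_eigen_def algebra_simps)
  qed
  \<comment> \<open>Multiplication by \<open>?y\<close> permutes \<open>T\<^sub>2\<close>, so the
    \<open>T\<^sub>2\<close>-sums based at \<open>g \<otimes> ?y\<close> and at \<open>g\<close>
    agree.\<close>
  have eq2: "of_int q * F (g \<otimes> ?y) = of_int q * F g" if g: "g \<in> carrier G" for g
  proof -
    have "of_int q * F (g \<otimes> ?y) = (\<Sum>a\<in>T\<^sub>2. F (g \<otimes> ?y \<otimes> a))"
      using q g by (simp add: right_sum_eigen_def)
    also have "\<dots> = (\<Sum>a\<in>T\<^sub>2. F (g \<otimes> a))"
    proof (rule sum.reindex_bij_witness[of _ "\<lambda>a. ?y \<otimes> a" "\<lambda>a. ?y \<otimes> a"])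
      fix a assume a: "a \<in> T\<^sub>2"
      then have aN: "a \<in> N" by (simp add: T\<^sub>2_def)
      have "?y \<otimes> (?y \<otimes> a) = ?y \<otimes> ?y \<otimes> a" using aN by (simp add: m_assoc)
      then show "?y \<otimes> (?y \<otimes> a) = a" using aN x_square_square by simp
      then show "?y \<otimes> (?y \<otimes> a) = a" .
      show "?y \<otimes> a \<in> T\<^sub>2" using yT[OF a] .
      then show "?y \<otimes> a \<in> T\<^sub>2" .
      show "F (g \<otimes> (?y \<otimes> a)) = F (g \<otimes> ?y \<otimes> a)" using aN g by (simp add: m_assoc)
    qed
    finally show ?thesis using q g by (simp add: right_sum_eigen_def)
  qed
  obtain g where g: "g \<in> carrier G" "F g \<noteq> 0" using F(2) by blast
  \<comment> \<open>Applying \<open>eq1\<close> at \<open>g\<close> and then at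
    \<open>g \<otimes> x\<close> never divides by \<open>q\<close>, so the case \<open>q = 0\<close>
    is included.\<close>
  have "(k - of_int p) * (k - of_int p) * F g = of_int q * ((k - of_int p) * F (g \<otimes> x))"
    using eq1[OF g(1)] by (metis mult.assoc mult.left_commute)
  also have "(k - of_int p) * F (g \<otimes> x) = of_int q * F (g \<otimes> ?y)"
    using eq1[of "g \<otimes> x"] g(1) by (simp add: m_assoc)
  also have "of_int q * F (g \<otimes> ?y) = of_int q * F g" using eq2[OF g(1)] .
  finally have "(k - of_int p) * (k - of_int p) = of_int q * of_int q"
    using g(2) by (simp add: mult.assoc[symmetric])
  then have "k - of_int p = of_int q \<or> k - of_int p = - of_int q"
    by (simp add: square_eq_iff)
  then have "k = of_int (p + q) \<or> k = of_int (p - q)" by (auto simp: algebra_simps)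
  then show ?thesis by auto
qed

end

section \<open>Closure of \<open>B(A)\<close> under powers, and adjacency eigenvectors as
  functions\<close>

context group
begin

text \<open>Subgroups are closed under all powers; coprimality enters through complements, where an
  inverse exponent carries a power of \<open>a\<close> back to \<open>a\<close>.\<close>

lemma subgroup_algebra_power_closed:
  assumes fin: "finite (carrier G)" and T: "T \<in> subgroup_algebra G"
    and k: "coprime k (Coset.order G)" and a: "a \<in> T"
  shows "a [^] (k::nat) \<in> T"
proof -
  \<comment> \<open>The exponent is quantified inside the induction because the complement case
    applies the hypothesis to the inverse exponent.\<close>
  have "T \<subseteq> carrier G \<and> (\<forall>a\<in>T. \<forall>k::nat. coprime k (Coset.order G) \<longrightarrow> a [^] k \<in> T)"
    using T
  proof (induction rule: subgroup_algebra.induct)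
    case (subgroup H)
    have "a [^] j \<in> H" if "a \<in> H" for a and j :: nat
      using subgroup subgroup.one_closed subgroup.m_closed that by (induction j) fastforce+
    then show ?case using subgroup.subset[OF subgroup] by blast
  next
    case (compl P)
    have "a [^] k \<notin> P" if a: "a \<in> carrier G" "a \<notin> P" and k: "coprime k (Coset.order G)" for a and k :: nat
    proof
      assume in_P: "a [^] k \<in> P"
      obtain l where l: "[k * l = 1] (mod Coset.order G)" using cong_solve_coprime_nat[OF k] by auto
      then have "coprime l (Coset.order G)"
        using coprime_iff_invertible_nat[of l] by (auto simp: mult.commute)
      then have "(a [^] k) [^] l \<in> P" using compl.IH in_P by blast
      moreover have "[k * l = 1] (mod ord a)"
        using l ord_dvd_group_order[OF a(1)] cong_dvd_modulus_nat by blast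
      then have "(a [^] k) [^] l = a"
        using a(1) pow_eq_iff_cong[OF a(1), of "k * l" 1] by (simp add: nat_pow_pow)
      ultimately show False using a(2) by simp
    qed
    then show ?case using compl.IH by auto
  qed auto
  then show ?thesis using a k by blast
qed

text \<open>The row of the adjacency matrix at \<open>g\<close> is the indicator of
  \<open>g T\<close>, so an eigenvector read as a function on the group is an eigenfunction of right
  summation over \<open>T\<close>.\<close>

lemma adjacency_eigenfunction:
  assumes T: "T \<subseteq> carrier G" "set_inv T = T"
    and vs: "distinct vs" "set vs = carrier G"
    and k: "eigenvalue (adjacency_matrix (cayley_graph G T) vs) k"
  shows "\<exists>f. right_sum_eigen G T k f \<and> (\<exists>g\<in>carrier G. f g \<noteq> 0)"
proof -
  let ?M = "adjacency_matrix (cayley_graph G T) vs" and ?n = "length vs"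
  have fin: "finite (carrier G)" using vs(2) by (metis finite_set)
  have bij: "bij_betw (\<lambda>i. vs ! i) {..<?n} (carrier G)"
    using bij_betw_nth[OF vs(1)] vs(2) by simp
  obtain v where v: "v \<in> carrier_vec ?n" "v \<noteq> 0\<^sub>v ?n" "?M *\<^sub>v v = k \<cdot>\<^sub>v v"
    using k by (auto simp: eigenvalue_def eigenvector_def adjacency_matrix_def)
  define f where "f g = v $ inv_into {..<?n} (\<lambda>i. vs ! i) g" for g
  have f_nth: "f (vs ! i) = v $ i" if "i < ?n" for i
    using bij_betw_inv_into_left[OF bij, of i] that by (simp add: f_def)
  have "(\<Sum>s\<in>T. f (g \<otimes> s)) = k * f g" if g: "g \<in> carrier G" for g
  proof -
    obtain i where i: "i < ?n" "g = vs ! i" using g in_set_conv_nth[of g vs] unfolding vs(2) by blast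
    have "k * f g = (?M *\<^sub>v v) $ i"
      unfolding v(3) i(2) f_nth[OF i(1)] using carrier_vecD[OF v(1)] i(1) by simp
    also have "\<dots> = (\<Sum>j<?n. ?M $$ (i, j) * v $ j)"
      using i v(1) by (simp add: adjacency_matrix_def scalar_prod_def lessThan_atLeast0)
    also have "\<dots> = (\<Sum>j<?n. if inv g \<otimes> vs ! j \<in> T then f (vs ! j) else 0)"
    proof (rule sum.cong[OF HOL.refl])
      fix j assume j: "j \<in> {..<?n}"
      then have "vs ! j \<in> carrier G" using nth_mem[of j vs] unfolding vs(2) by simp
      then have "{vs ! i, vs ! j} \<in> snd (cayley_graph G T) \<longleftrightarrow> inv g \<otimes> vs ! j \<in> T"
        unfolding cayley_edge_iff[OF T(2)] i(2)[symmetric] using g by simp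
      then show "?M $$ (i, j) * v $ j = (if inv g \<otimes> vs ! j \<in> T then f (vs ! j) else 0)"
        using i j f_nth by (simp add: adjacency_matrix_def)
    qed
    also have "\<dots> = (\<Sum>h\<in>carrier G. if inv g \<otimes> h \<in> T then f h else 0)"
      by (rule sum.reindex_bij_betw[OF bij])
    also have "\<dots> = (\<Sum>h\<in>{h \<in> carrier G. inv g \<otimes> h \<in> T}. f h)"
      using fin by (simp add: sum.inter_filter)
    also have "\<dots> = (\<Sum>s\<in>T. f (g \<otimes> s))"
      by (rule sum.reindex_bij_witness[of _ "\<lambda>s. g \<otimes> s" "\<lambda>h. inv g \<otimes> h"])
         (use T(1) g in auto)
    finally show ?thesis by simp
  qed
  moreover have "\<exists>g\<in>carrier G. f g \<noteq> 0"
  proof (rule ccontr)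
    assume "\<not> ?thesis"
    then have "v $ i = 0" if "i < ?n" for i
      using f_nth[OF that] nth_mem[OF that] unfolding vs(2) by metis
    then have "v = 0\<^sub>v ?n" using v(1) by (intro eq_vecI) auto
    then show False using v(2) by simp
  qed
  ultimately show ?thesis unfolding right_sum_eigen_def by blast
qed

end

lemma (in inverting_extension) integral_cayley_graph:
  assumes "power_invariant T" "set_inv T = T"
  shows "integral_graph (cayley_graph G T)"
  unfolding integral_graph_def
proof (intro conjI allI impI)
  show "finite (fst (cayley_graph G T))" using finite_carrier by (simp add: cayley_graph_def)
  fix vs k
  assume "distinct vs \<and> set vs = fst (cayley_graph G T)"
    and k: "eigenvalue (adjacency_matrix (cayley_graph G T) vs) k"
  then have vs: "distinct vs" "set vs = carrier G" by (auto simp: cayley_graph_def)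
  have "T \<subseteq> carrier G" using assms(1) by (simp add: power_invariant_def)
  then show "k \<in> \<int>"
    using adjacency_eigenfunction[OF _ assms(2) vs k] integer_eigenvalue[OF assms] by blast
qed

text \<open>On \<open>N\<close>, inversion is the power with exponent \<open>card N - 1\<close>,
  which is coprime to \<open>card N\<close>.\<close>

lemma (in inverting_extension) power_invariant_x_inv:
  assumes "power_invariant T" "a \<in> N" "x \<otimes> a \<in> T"
  shows "x \<otimes> inv a \<in> T"
proof -
  have n: "card N > 0" using assms(2) finite_N card_gt_0_iff by blast
  have "a [^] (card N - 1) \<otimes> a = \<one>"
    using pow_card_N[OF assms(2)] n by (simp flip: nat_pow_Suc)
  then have "inv a = a [^] (card N - 1)" using assms(2) by (intro inv_equality) auto
  moreover have "coprime (card N - 1) (card N)" by (rule coprime_diff_one_left_nat[OF n])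
  ultimately show ?thesis
    using assms power_aut_x[OF assms(2), of "card N - 1"] unfolding power_invariant_def by metis
qed

section \<open>The presented dicyclic group\<close>

lemma group_words_append [simp]:
  "u @ v \<in> group_words X \<longleftrightarrow> u \<in> group_words X \<and> v \<in> group_words X"
  by (auto simp: group_words_def)

lemma group_words_Nil [simp]: "[] \<in> group_words X"
  by (simp add: group_words_def)

lemma group_words_Cons [simp]:
  "(g, b) # u \<in> group_words X \<longleftrightarrow> g \<in> X \<and> u \<in> group_words X"
  by (auto simp: group_words_def)

lemma presentation_rel_closed:
  "(u, v) \<in> presentation_rel X R \<Longrightarrow> u \<in> group_words X \<and> v \<in> group_words X"
  by (induction rule: presentation_rel.induct) auto

lemma equiv_presentation_rel: "equiv (group_words X) (presentation_rel X R)"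
proof (rule equivI)
  show "presentation_rel X R \<subseteq> group_words X \<times> group_words X"
    using presentation_rel_closed by fast
  show "refl_on (group_words X) (presentation_rel X R)"
    by (auto intro!: refl_onI presentation_rel.refl)
  show "Relation.sym (presentation_rel X R)"
    by (auto intro!: symI presentation_rel.sym)
  show "Relation.trans (presentation_rel X R)"
    by (intro transI) (rule presentation_rel.trans)
qed

lemma presentation_rel_append_context:
  assumes "(u, v) \<in> presentation_rel X R" "p \<in> group_words X" "q \<in> group_words X"
  shows "(p @ u @ q, p @ v @ q) \<in> presentation_rel X R"
  using assms(1)
proof (induction rule: presentation_rel.induct)
  case (refl w)
  then show ?case using assms(2,3) by (intro presentation_rel.refl) simp
next
  case (sym u v)
  show ?case using presentation_rel.sym[OF sym(2)] .
next
  case (trans u v w)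
  then show ?case by (blast intro: presentation_rel.trans)
next
  case (cancel u v g b)
  then show ?case using presentation_rel.cancel[of "p @ u" X "v @ q" g b R] assms(2,3) by simp
next
  case (relation u v l r)
  then show ?case using presentation_rel.relation[of "p @ u" X "v @ q" l r R] assms(2,3) by simp
qed

lemma presentation_rel_append:
  assumes "(u, u') \<in> presentation_rel X R" "(v, v') \<in> presentation_rel X R"
  shows "(u @ v, u' @ v') \<in> presentation_rel X R"
  using presentation_rel_append_context[OF assms(1), of "[]" v]
    presentation_rel_append_context[OF assms(2), of u' "[]"]
    presentation_rel_closed[OF assms(1)] presentation_rel_closed[OF assms(2)]
  by (auto intro: presentation_rel.trans)

abbreviation word_class where
  "word_class X R w \<equiv> presentation_rel X R `` {w}"

lemma word_class_eq_iff:
  assumes "u \<in> group_words X" "v \<in> group_words X"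
  shows "word_class X R u = word_class X R v \<longleftrightarrow> (u, v) \<in> presentation_rel X R"
  using eq_equiv_class_iff[OF equiv_presentation_rel assms] .

lemma presented_group_mult:
  assumes "u \<in> group_words X" "v \<in> group_words X"
  shows "word_class X R u \<otimes>\<^bsub>presented_group X R\<^esub> word_class X R v = word_class X R (u @ v)"
proof -
  let ?E = "presentation_rel X R"
  have "?E `` {p @ q |p q. p \<in> ?E `` {u} \<and> q \<in> ?E `` {v}} = ?E `` {u @ v}"
  proof
    show "?E `` {p @ q |p q. p \<in> ?E `` {u} \<and> q \<in> ?E `` {v}} \<subseteq> ?E `` {u @ v}"
      by (auto intro: presentation_rel.trans presentation_rel_append)
    have "u \<in> ?E `` {u}" "v \<in> ?E `` {v}" using assms by (auto intro: presentation_rel.refl)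
    then show "?E `` {u @ v} \<subseteq> ?E `` {p @ q |p q. p \<in> ?E `` {u} \<and> q \<in> ?E `` {v}}" by blast
  qed
  then show ?thesis by (simp add: presented_group_def)
qed

lemma presented_group_carrierE:
  assumes "P \<in> carrier (presented_group X R)"
  obtains w where "w \<in> group_words X" "P = word_class X R w"
  using assms by (auto simp: presented_group_def elim: quotientE)

lemma word_class_in_carrier [intro]:
  "w \<in> group_words X \<Longrightarrow> word_class X R w \<in> carrier (presented_group X R)"
  by (simp add: presented_group_def quotientI)

lemma presented_group_one: "\<one>\<^bsub>presented_group X R\<^esub> = word_class X R []"
  by (simp add: presented_group_def)

text \<open>The witness built by the induction is the reversed word with all signs flipped; a left
  inverse is all that \<open>groupI\<close> asks for.\<close>

lemma inverse_word:
  assumes "w \<in> group_words X"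
  shows "\<exists>w'\<in>group_words X. (w' @ w, []) \<in> presentation_rel X R"
  using assms
proof (induction w)
  case Nil
  show ?case by (intro bexI[of _ "[]"]) (auto intro: presentation_rel.refl)
next
  case (Cons l w)
  obtain g b where l: "l = (g, b)" by (cases l)
  with Cons obtain w' where w': "w' \<in> group_words X" "(w' @ w, []) \<in> presentation_rel X R" by auto
  have "(w' @ [(g, \<not> b), (g, \<not> \<not> b)] @ w, w' @ w) \<in> presentation_rel X R"
    using Cons.prems l w'(1) by (intro presentation_rel.cancel) auto
  then have "((w' @ [(g, \<not> b)]) @ l # w, []) \<in> presentation_rel X R"
    using presentation_rel.trans[OF _ w'(2)] l by simp
  then show ?case using Cons.prems l w'(1) by (intro bexI[of _ "w' @ [(g, \<not> b)]"]) auto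
qed

lemma group_presented_group: "group (presented_group X R)"
proof (rule groupI)
  let ?G = "presented_group X R"
  show "\<one>\<^bsub>?G\<^esub> \<in> carrier ?G" by (simp add: presented_group_one word_class_in_carrier)
  fix P assume "P \<in> carrier ?G"
  then obtain u where u: "u \<in> group_words X" "P = word_class X R u" by (elim presented_group_carrierE)
  show "\<one>\<^bsub>?G\<^esub> \<otimes>\<^bsub>?G\<^esub> P = P" using u by (simp add: presented_group_one presented_group_mult)
  obtain u' where u': "u' \<in> group_words X" "(u' @ u, []) \<in> presentation_rel X R"
    using inverse_word[OF u(1)] by blast
  then have "word_class X R u' \<otimes>\<^bsub>?G\<^esub> P = \<one>\<^bsub>?G\<^esub>"
    using u by (simp add: presented_group_mult presented_group_one word_class_eq_iff)
  then show "\<exists>Q\<in>carrier ?G. Q \<otimes>\<^bsub>?G\<^esub> P = \<one>\<^bsub>?G\<^esub>" using u' by blast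
  fix Q assume "Q \<in> carrier ?G"
  then obtain v where v: "v \<in> group_words X" "Q = word_class X R v" by (elim presented_group_carrierE)
  show "P \<otimes>\<^bsub>?G\<^esub> Q \<in> carrier ?G" using u v by (auto simp: presented_group_mult)
  fix K assume "K \<in> carrier ?G"
  then obtain w where w: "w \<in> group_words X" "K = word_class X R w" by (elim presented_group_carrierE)
  show "P \<otimes>\<^bsub>?G\<^esub> Q \<otimes>\<^bsub>?G\<^esub> K = P \<otimes>\<^bsub>?G\<^esub> (Q \<otimes>\<^bsub>?G\<^esub> K)"
    using u v w by (simp add: presented_group_mult)
qed

section \<open>Normal forms in the dicyclic group\<close>

locale dicyclic = A: comm_group A for A :: "('a, 'm) monoid_scheme" (structure) +
  fixes y :: 'a
  assumes y_closed [simp]: "y \<in> carrier A" and y_square: "y \<otimes> y = \<one>"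
begin

abbreviation "X \<equiv> dic_gens A"
abbreviation "R \<equiv> dic_relations A y"

lemma GenX_mem [simp]: "GenX \<in> X" by (simp add: dic_gens_def)

lemma GenA_mem [simp]: "GenA a \<in> X \<longleftrightarrow> a \<in> carrier A" by (auto simp: dic_gens_def)

lemma group_Dic: "group (Dic A y)"
  unfolding Dic_def by (rule group_presented_group)

sublocale Dic: group "Dic A y" by (rule group_Dic)

lemma Dic_mult:
  "u \<in> group_words X \<Longrightarrow> v \<in> group_words X \<Longrightarrow>
    word_class X R u \<otimes>\<^bsub>Dic A y\<^esub> word_class X R v = word_class X R (u @ v)"
  unfolding Dic_def by (rule presented_group_mult)

lemma Dic_one: "\<one>\<^bsub>Dic A y\<^esub> = word_class X R []"
  unfolding Dic_def by (rule presented_group_one)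

lemma Dic_relation:
  assumes "(l, r) \<in> R" "l \<in> group_words X" "r \<in> group_words X"
  shows "word_class X R l = word_class X R r"
  using presentation_rel.relation[of "[]" X "[]" l r R] assms by (simp add: word_class_eq_iff)

lemma Dic_closed [intro]: "w \<in> group_words X \<Longrightarrow> word_class X R w \<in> carrier (Dic A y)"
  unfolding Dic_def by (rule word_class_in_carrier)

lemma emb_closed [simp]: "a \<in> carrier A \<Longrightarrow> dic_emb A y a \<in> carrier (Dic A y)"
  unfolding dic_emb_def by (intro Dic_closed) simp

lemma dic_x_closed [simp]: "dic_x A y \<in> carrier (Dic A y)"
  unfolding dic_x_def by (intro Dic_closed) simp

lemma emb_mult:
  assumes "a \<in> carrier A" "b \<in> carrier A"
  shows "dic_emb A y (a \<otimes> b) = dic_emb A y a \<otimes>\<^bsub>Dic A y\<^esub> dic_emb A y b"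
proof -
  have "word_class X R [(GenA a, True), (GenA b, True)] = word_class X R [(GenA (a \<otimes> b), True)]"
    using assms by (intro Dic_relation) (auto simp: dic_relations_def)
  then show ?thesis using assms by (simp add: dic_emb_def Dic_mult)
qed

lemma emb_hom: "group_hom A (Dic A y) (dic_emb A y)"
  using emb_mult by unfold_locales (auto simp: hom_def)

lemma emb_inv: "a \<in> carrier A \<Longrightarrow> dic_emb A y (inv a) = inv\<^bsub>Dic A y\<^esub> dic_emb A y a"
  using group_hom.hom_inv[OF emb_hom] .

lemma letter_inv:
  assumes "g \<in> X"
  shows "word_class X R [(g, False)] = inv\<^bsub>Dic A y\<^esub> word_class X R [(g, True)]"
proof (rule Dic.inv_equality[symmetric])
  have "([] @ [(g, False), (g, \<not> False)] @ [], [] @ []) \<in> presentation_rel X R"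
    using assms by (intro presentation_rel.cancel) auto
  then show "word_class X R [(g, False)] \<otimes>\<^bsub>Dic A y\<^esub> word_class X R [(g, True)] = \<one>\<^bsub>Dic A y\<^esub>"
    using assms by (simp add: Dic_mult Dic_one word_class_eq_iff)
qed (use assms in auto)

lemma dic_x_square: "dic_x A y \<otimes>\<^bsub>Dic A y\<^esub> dic_x A y = dic_emb A y y"
proof -
  have "word_class X R [(GenX, True), (GenX, True)] = word_class X R [(GenA y, True)]"
    by (intro Dic_relation) (auto simp: dic_relations_def)
  then show ?thesis by (simp add: dic_emb_def dic_x_def Dic_mult)
qed

lemma dic_x_inverts:
  assumes "a \<in> carrier A"
  shows "dic_x A y \<otimes>\<^bsub>Dic A y\<^esub> dic_emb A y a \<otimes>\<^bsub>Dic A y\<^esub> inv\<^bsub>Dic A y\<^esub> dic_x A y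
    = inv\<^bsub>Dic A y\<^esub> dic_emb A y a"
proof -
  have "word_class X R [(GenX, True), (GenA a, True), (GenX, False)] = word_class X R [(GenA a, False)]"
    using assms by (intro Dic_relation) (auto simp: dic_relations_def)
  then show ?thesis
    using assms by (simp add: dic_emb_def dic_x_def Dic_mult flip: letter_inv)
qed

text \<open>The left regular action of the dicyclic group in normal form: \<open>(a, False)\<close> stands for \<open>a\<close> and
  \<open>(a, True)\<close> for \<open>x a\<close>.\<close>

fun letter_action :: "'a dic_gen \<times> bool \<Rightarrow> 'a \<times> bool \<Rightarrow> 'a \<times> bool" where
  "letter_action (GenA c, s) (a, t) = ((if s = t then inv c \<otimes> a else c \<otimes> a), t)"
| "letter_action (GenX, s) (a, t) = ((if s = t then y \<otimes> a else a), \<not> t)"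

definition word_action :: "'a dic_gen group_word \<Rightarrow> 'a \<times> bool \<Rightarrow> 'a \<times> bool" where
  "word_action = foldr letter_action"

lemma word_action_simps [simp]:
  "word_action [] p = p"
  "word_action (l # w) p = letter_action l (word_action w p)"
  "word_action (u @ v) p = word_action u (word_action v p)"
  by (simp_all add: word_action_def)

lemma word_action_closed:
  "w \<in> group_words X \<Longrightarrow> fst p \<in> carrier A \<Longrightarrow> fst (word_action w p) \<in> carrier A"
proof (induction w)
  case (Cons l w)
  obtain g s where l: "l = (g, s)" by (cases l)
  obtain a t where at: "word_action w p = (a, t)" by (cases "word_action w p")
  have "a \<in> carrier A" "g \<in> X" using Cons l at by auto
  then show ?case using l at by (cases g) auto
qed simp

text \<open>The action respects the defining relations, so it separates group elements: words that
  act differently on some normal form represent different elements.\<close>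

lemma word_action_cong:
  "(u, v) \<in> presentation_rel X R \<Longrightarrow> fst p \<in> carrier A \<Longrightarrow> word_action u p = word_action v p"
proof (induction arbitrary: p rule: presentation_rel.induct)
  case (cancel u v g b)
  obtain a t where at: "word_action v p = (a, t)" by (cases "word_action v p")
  have a: "a \<in> carrier A" using word_action_closed[OF cancel(2) cancel(4)] at by simp
  have yy: "y \<otimes> (y \<otimes> a) = a" using a y_square by (simp flip: A.m_assoc)
  have "letter_action (g, b) (letter_action (g, \<not> b) (a, t)) = (a, t)"
    using cancel(3) a yy by (cases g) auto
  then show ?case using at by simp
next
  case (relation u v l r)
  obtain a t where at: "word_action v p = (a, t)" by (cases "word_action v p")
  have a: "a \<in> carrier A" using word_action_closed[OF relation(2) relation(6)] at by simp
  \<comment> \<open>These two facts settle the relation for conjugation by \<open>x\<close>, where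
    the letters for \<open>x\<close> and its inverse can contribute a factor \<open>y\<close> on
    either side of \<open>c\<close>.\<close>
  have "inv y = y" using A.inv_equality[OF y_square] by simp
  moreover have "y \<otimes> (c \<otimes> (y \<otimes> a)) = c \<otimes> a" if "c \<in> carrier A" for c
  proof -
    have "y \<otimes> (c \<otimes> (y \<otimes> a)) = c \<otimes> (y \<otimes> y \<otimes> a)" using a that by (simp add: A.m_ac)
    then show ?thesis using a y_square by simp
  qed
  ultimately have "word_action l (a, t) = word_action r (a, t)"
    using relation(3) a unfolding dic_relations_def by (auto simp: A.inv_mult A.m_assoc)
  then show ?case using at by simp
qed auto

text \<open>Acting on the normal form \<open>(\<one>, False)\<close> of the identity recovers
  \<open>a\<close> from its image.\<close>

lemma emb_eq_iff:
  assumes "a \<in> carrier A" "b \<in> carrier A"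
  shows "dic_emb A y a = dic_emb A y b \<longleftrightarrow> a = b"
  using assms word_action_cong[of "[(GenA a, True)]" "[(GenA b, True)]" "(\<one>, False)"]
  by (auto simp: dic_emb_def word_class_eq_iff intro: presentation_rel.refl)

text \<open>The letter \<open>GenX\<close> flips the Boolean component of a normal form, whereas
  letters from \<open>A\<close> keep it.\<close>

lemma dic_x_notin: "dic_x A y \<notin> dic_emb A y ` carrier A"
proof
  assume "dic_x A y \<in> dic_emb A y ` carrier A"
  then obtain a where "a \<in> carrier A" "([(GenX, True)], [(GenA a, True)]) \<in> presentation_rel X R"
    by (auto simp: dic_emb_def dic_x_def word_class_eq_iff)
  then show False using word_action_cong[of _ _ "(\<one>, False)"] by fastforce
qed

lemma x_emb_swap:
  assumes "a \<in> carrier A"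
  shows "dic_emb A y a \<otimes>\<^bsub>Dic A y\<^esub> dic_x A y = dic_x A y \<otimes>\<^bsub>Dic A y\<^esub> dic_emb A y (inv a)"
proof -
  let ?e = "dic_emb A y" let ?x = "dic_x A y"
  have "?x \<otimes>\<^bsub>Dic A y\<^esub> ?e (inv a) \<otimes>\<^bsub>Dic A y\<^esub> inv\<^bsub>Dic A y\<^esub> ?x = ?e a"
    using dic_x_inverts[of "inv a"] assms by (simp flip: emb_inv)
  then have "?e a \<otimes>\<^bsub>Dic A y\<^esub> ?x = ?x \<otimes>\<^bsub>Dic A y\<^esub> ?e (inv a) \<otimes>\<^bsub>Dic A y\<^esub> inv\<^bsub>Dic A y\<^esub> ?x \<otimes>\<^bsub>Dic A y\<^esub> ?x"
    by simp
  then show ?thesis using assms by (simp add: Dic.m_assoc)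
qed

text \<open>The set of normal forms contains the identity and is stable under left multiplication by
  every letter, so induction on words shows that it is everything.\<close>

lemma Dic_carrier:
  "carrier (Dic A y) = dic_emb A y ` carrier A \<union> (dic_x A y <#\<^bsub>Dic A y\<^esub> (dic_emb A y ` carrier A))"
    (is "_ = ?K")
proof
  let ?e = "dic_emb A y" let ?x = "dic_x A y" let ?D = "Dic A y"
  show "?K \<subseteq> carrier ?D" by (auto simp: l_coset_def)
  have A_K: "?e a \<otimes>\<^bsub>?D\<^esub> P \<in> ?K" if a: "a \<in> carrier A" and P: "P \<in> ?K" for a P
  proof -
    consider b where "b \<in> carrier A" "P = ?e b" | b where "b \<in> carrier A" "P = ?x \<otimes>\<^bsub>?D\<^esub> ?e b"
      using P by (auto simp: l_coset_def)
    then show ?thesis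
    proof cases
      case 1
      then show ?thesis using a by (auto simp flip: emb_mult)
    next
      case 2
      then have "?e a \<otimes>\<^bsub>?D\<^esub> P = ?x \<otimes>\<^bsub>?D\<^esub> ?e (inv a \<otimes> b)"
        using a x_emb_swap[OF a] by (simp add: emb_mult flip: Dic.m_assoc)
      then show ?thesis using a 2 by (auto simp: l_coset_def)
    qed
  qed
  have x_K: "?x \<otimes>\<^bsub>?D\<^esub> P \<in> ?K" if P: "P \<in> ?K" for P
  proof -
    consider b where "b \<in> carrier A" "P = ?e b" | b where "b \<in> carrier A" "P = ?x \<otimes>\<^bsub>?D\<^esub> ?e b"
      using P by (auto simp: l_coset_def)
    then show ?thesis
    proof cases
      case 1
      then show ?thesis by (auto simp: l_coset_def)
    next
      case 2
      then have "?x \<otimes>\<^bsub>?D\<^esub> P = ?e (y \<otimes> b)"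
        by (simp add: emb_mult dic_x_square flip: Dic.m_assoc)
      then show ?thesis using 2 by auto
    qed
  qed
  \<comment> \<open>This reduces the inverse letter of \<open>x\<close> to multiplications already
    treated.\<close>
  have inv_x: "inv\<^bsub>?D\<^esub> ?x = ?e y \<otimes>\<^bsub>?D\<^esub> ?x"
  proof (rule Dic.inv_equality)
    show "?e y \<otimes>\<^bsub>?D\<^esub> ?x \<otimes>\<^bsub>?D\<^esub> ?x = \<one>\<^bsub>?D\<^esub>"
      using group_hom.hom_one[OF emb_hom]
      by (simp add: Dic.m_assoc dic_x_square y_square flip: emb_mult)
  qed simp_all
  have letter_K: "word_class X R [l] \<otimes>\<^bsub>?D\<^esub> P \<in> ?K" if l: "fst l \<in> X" and P: "P \<in> ?K" for l P
  proof -
    obtain g s where gs: "l = (g, s)" by (cases l)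
    have Pc: "P \<in> carrier ?D" using P by (auto simp: l_coset_def)
    show ?thesis
    proof (cases g)
      case (GenA c)
      then have c: "c \<in> carrier A" using l gs by simp
      then have "word_class X R [l] = ?e (if s then c else inv c)"
        using gs GenA letter_inv[of g] l by (auto simp: dic_emb_def[of A y c] emb_inv)
      then show ?thesis using A_K P c by simp
    next
      case GenX
      show ?thesis
      proof (cases s)
        case True
        then show ?thesis using gs GenX x_K[OF P] by (simp add: dic_x_def)
      next
        case False
        then have "word_class X R [l] = ?e y \<otimes>\<^bsub>?D\<^esub> ?x"
          using gs GenX letter_inv[of GenX] inv_x by (simp add: dic_x_def)
        then have "word_class X R [l] \<otimes>\<^bsub>?D\<^esub> P = ?e y \<otimes>\<^bsub>?D\<^esub> (?x \<otimes>\<^bsub>?D\<^esub> P)"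
          using Pc by (simp add: Dic.m_assoc)
        then show ?thesis using A_K[OF y_closed x_K[OF P]] by simp
      qed
    qed
  qed
  have one_K: "\<one>\<^bsub>?D\<^esub> \<in> ?K"
    using group_hom.hom_one[OF emb_hom] by (metis A.one_closed UnI1 image_eqI)
  have "word_class X R w \<in> ?K" if "w \<in> group_words X" for w
    using that
  proof (induction w)
    case Nil
    then show ?case using one_K by (simp add: Dic_one)
  next
    case (Cons l w)
    then have l: "fst l \<in> X" and w: "w \<in> group_words X" by (cases l, auto)+
    have "word_class X R (l # w) = word_class X R [l] \<otimes>\<^bsub>?D\<^esub> word_class X R w"
      using l w by (cases l) (simp add: Dic_mult)
    then show ?case using letter_K[OF l Cons.IH[OF w]] by simp
  qed
  then show "carrier ?D \<subseteq> ?K"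
    by (auto simp: Dic_def elim!: presented_group_carrierE)
qed

end

section \<open>Distance powers over the dicyclic group\<close>

theorem theorem4p1:
  fixes A :: "('a, 'm) monoid_scheme" and y :: 'a
    and S :: "'a dic_gen group_word set set" and S\<^sub>1 S\<^sub>2 :: "'a set" and D :: "nat set"
  assumes "comm_group A" and "finite (carrier A)" and "even (Coset.order A)"
    and "group_exponent A \<ge> 3"
    and "y \<in> carrier A" and "group.ord A y = 2"
    and "S \<subseteq> carrier (Dic A y)"
    and "\<one>\<^bsub>Dic A y\<^esub> \<notin> S" and "set_inv\<^bsub>Dic A y\<^esub> S = S"
    and "generate (Dic A y) S = carrier (Dic A y)"
    and "finite D" and "D \<noteq> {}" and "\<forall>d\<in>D. d > 0"
    and "S\<^sub>1 \<subseteq> carrier A" and "S\<^sub>2 \<subseteq> carrier A"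
    and "S = dic_subset A y S\<^sub>1 S\<^sub>2"
    and "S\<^sub>1 \<in> subgroup_algebra A" and "S\<^sub>2 \<in> subgroup_algebra A"
  shows "\<exists>S\<^sub>1D S\<^sub>2D SD. S\<^sub>1D \<subseteq> carrier A \<and> S\<^sub>2D \<subseteq> carrier A \<and> SD = dic_subset A y S\<^sub>1D S\<^sub>2D
    \<and> \<one>\<^bsub>Dic A y\<^esub> \<notin> SD \<and> set_inv\<^bsub>Dic A y\<^esub> SD = SD
    \<and> distance_power (cayley_graph (Dic A y) S) D = cayley_graph (Dic A y) SD
    \<and> integral_graph (distance_power (cayley_graph (Dic A y) S) D)
    \<and> S\<^sub>2D = set_inv\<^bsub>A\<^esub> S\<^sub>2D
    \<and> (1 \<in> D \<longrightarrow> connected_graph (distance_power (cayley_graph (Dic A y) S) D))"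
proof -
  interpret A: comm_group A by fact
  have "y [^]\<^bsub>A\<^esub> (2::nat) = \<one>\<^bsub>A\<^esub>" using A.pow_ord_eq_1[OF assms(5)] assms(6) by simp
  then interpret dicyclic A y
    using assms(5) by unfold_locales (auto simp: numeral_2_eq_2)
  let ?G = "Dic A y" and ?e = "dic_emb A y" and ?x = "dic_x A y"
  let ?N = "?e ` carrier A"
  interpret e: group_hom A ?G ?e by (rule emb_hom)
  have card_N: "card ?N = Coset.order A"
    unfolding Coset.order_def by (intro card_image inj_onI) (simp add: emb_eq_iff)
  interpret inverting_extension ?G ?N ?x
  proof (intro inverting_extension.intro inverting_extension_axioms.intro)
    show "group ?G" by (rule group_Dic)
    show "subgroup ?N ?G" by (rule e.img_is_subgroup)
    show "finite ?N" using assms(2) by simp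
    show "even (card ?N)" using assms(3) card_N by simp
    show "a \<otimes>\<^bsub>?G\<^esub> b = b \<otimes>\<^bsub>?G\<^esub> a" if ab: "a \<in> ?N" "b \<in> ?N" for a b
    proof -
      obtain a' where a': "a' \<in> carrier A" "a = ?e a'" using ab(1) by (rule imageE)
      obtain b' where b': "b' \<in> carrier A" "b = ?e b'" using ab(2) by (rule imageE)
      show ?thesis unfolding a'(2) b'(2)
        using emb_mult[OF a'(1) b'(1)] emb_mult[OF b'(1) a'(1)] A.m_comm[OF a'(1) b'(1)] by simp
    qed
    show "?x \<notin> ?N" by (rule dic_x_notin)
    show "carrier ?G = ?N \<union> (?x <#\<^bsub>?G\<^esub> ?N)" by (rule Dic_carrier)
    show "?x \<otimes>\<^bsub>?G\<^esub> a \<otimes>\<^bsub>?G\<^esub> inv\<^bsub>?G\<^esub> ?x = inv\<^bsub>?G\<^esub> a" if "a \<in> ?N" for a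
      using that dic_x_inverts by blast
    show "?x \<otimes>\<^bsub>?G\<^esub> ?x \<in> ?N" unfolding dic_x_square using y_closed by (rule imageI)
  qed simp
  \<comment> \<open>The connection set of the distance power; its two parts are read off as
    coordinates in \<open>A\<close> and in the coset of \<open>?x\<close>.\<close>
  define SD where "SD = (\<Union>d\<in>D. word_sphere ?G S d)"
  define S\<^sub>1D S\<^sub>2D where "S\<^sub>1D = {a \<in> carrier A. ?e a \<in> SD}"
    and "S\<^sub>2D = {a \<in> carrier A. ?x \<otimes>\<^bsub>?G\<^esub> ?e a \<in> SD}"
  have SD_closed: "SD \<subseteq> carrier ?G"
    unfolding SD_def using Dic.word_sphere_subset[OF assms(7)] by blast
  have SD_inv: "set_inv\<^bsub>?G\<^esub> SD = SD"
    using Dic.word_sphere_inv_closed[OF assms(7,9)]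
    by (intro Dic.set_inv_eqI SD_closed) (auto simp: SD_def)
  \<comment> \<open>Power closure is carried from \<open>A\<close> to its image, where exponents are
    tested against \<open>card ?N\<close>, the order of \<open>A\<close>.\<close>
  have pow: "b [^]\<^bsub>?G\<^esub> k \<in> ?e ` U"
    if "U \<in> subgroup_algebra A" "U \<subseteq> carrier A" "coprime k (card ?N)" "b \<in> ?e ` U" for U b and k :: nat
  proof -
    obtain a where a: "a \<in> U" "b = ?e a" using \<open>b \<in> ?e ` U\<close> by blast
    have "a [^]\<^bsub>A\<^esub> k \<in> U"
      using A.subgroup_algebra_power_closed[OF assms(2) that(1) _ a(1)] that(3) card_N by simp
    moreover have "?e (a [^]\<^bsub>A\<^esub> k) = b [^]\<^bsub>?G\<^esub> k" using e.hom_nat_pow a that(2) by blast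
    ultimately show ?thesis by (metis image_eqI)
  qed
  have "power_invariant S"
    unfolding assms(16) dic_subset_def using assms(14,15,17,18)
    by (intro power_invariantI pow image_mono)
  then have SD_inva: "power_invariant SD"
    unfolding SD_def by (intro power_invariant_UN power_invariant_word_sphere)
  have dist: "distance_power (cayley_graph ?G S) D = cayley_graph ?G SD"
    unfolding SD_def by (rule Dic.distance_power_cayley_graph[OF assms(7,9,13)])
  have "SD = dic_subset A y S\<^sub>1D S\<^sub>2D"
    using SD_closed Dic_carrier unfolding dic_subset_def S\<^sub>1D_def S\<^sub>2D_def l_coset_def by auto
  moreover have "\<one>\<^bsub>?G\<^esub> \<notin> SD"
    unfolding SD_def using Dic.one_notin_word_sphere assms(13) by blast
  moreover have "S\<^sub>2D = set_inv\<^bsub>A\<^esub> S\<^sub>2D"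
  proof (rule A.set_inv_eqI[symmetric])
    show "S\<^sub>2D \<subseteq> carrier A" by (auto simp: S\<^sub>2D_def)
    show "inv\<^bsub>A\<^esub> a \<in> S\<^sub>2D" if "a \<in> S\<^sub>2D" for a
      using that power_invariant_x_inv[OF SD_inva, of "?e a"] by (auto simp: S\<^sub>2D_def emb_inv)
  qed
  moreover have "connected_graph (cayley_graph ?G SD)" if "1 \<in> D"
  proof -
    \<comment> \<open>For 1 in \<open>D\<close> the new connection set contains \<open>S\<close>,
      hence still generates the group.\<close>
    have "S \<subseteq> word_sphere ?G S 1"
      by (rule Dic.subset_word_sphere_one[OF assms(7,8)])
    then have "S \<subseteq> SD" using that unfolding SD_def by blast
    then have "generate ?G SD = carrier ?G"
      using Dic.mono_generate[of S SD] assms(10) Dic.generate_incl[OF SD_closed] by blast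
    then show ?thesis by (rule Dic.connected_cayley_graph[OF SD_closed SD_inv])
  qed
  moreover have "S\<^sub>1D \<subseteq> carrier A" "S\<^sub>2D \<subseteq> carrier A"
    unfolding S\<^sub>1D_def S\<^sub>2D_def by blast+
  ultimately show ?thesis
    unfolding dist using SD_inv integral_cayley_graph[OF SD_inva SD_inv] by blast
qed

end
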